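(* Let $\mathfrak{g}$ be a non-abelian six-dimensional nilpotent real Lie algebra. Then $\mathfrak{g}$ possesses an integrable Born structure $(h,J,\mathfrak{g}_\pm)$ if and only if $\mathfrak{g}$ is isomorphic to one of the following Lie algebras: $$\mathfrak{h}_4=(0,0,0,0,12,14+23),\quad \mathfrak{h}_7=(0,0,0,12,13,23),\quad \mathfrak{h}_8=(0,0,0,0,0,12),\quad \mathfrak{h}_9=(0,0,0,0,12,14+25),$$ $$\mathfrak{h}_{10}=(0,0,0,12,13,14),\quad \mathfrak{h}_{11}=(0,0,0,12,13,14+23),\quad \mathfrak{h}_{13}=(0,0,0,12,13+14,24).$$
   Context: All Lie algebras are real and finite-dimensional. A pseudo-Riemannian metric on a Lie algebra is a non-degenerate symmetric bilinear form of arbitrary signature. Born structures. For non-degenerate bilinear forms $a,b$ on a vector space, the recursion operator from $a$ to $b$ is the unique invertible endomorphism $A$ with $a(A\cdot,\cdot)=b(\cdot,\cdot)$. A Born structure on a Lie algebra $\mathfrak{g}$ is a triple $(g,h,\omega)$ of two pseudo-Riemannian metrics $g,h$ and a non-degenerate two-form $\omega$ such that the recursion operators $A$ from $g$ to $\omega$, $B$ from $g$ to $h$ and $-J$ from $\omega$ to $h$ satisfy $A^2=B^2=-J^2=\mathrm{Id}$. It is integrable if $\omega$ is closed under the Chevalley–Eilenberg differential, the Nijenhuis tensor of $J$ vanishes, and the $\pm1$-eigenspaces of $A$ are subalgebras. A Born structure is equivalently encoded as $(h,J,\mathfrak{g}_\pm)$, where $J^2=-\mathrm{Id}$, $h(J\cdot,J\cdot)=h$,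 and $\mathfrak{g}=\mathfrak{g}_+\oplus\mathfrak{g}_-$ is an $h$-orthogonal splitting whose summands (the $\pm1$-eigenspaces of $A$) are interchanged by $J$; then $\omega=h(J\cdot,\cdot)$ and $g=\omega(A\cdot,\cdot)$. Salamon's notation: a tuple such as $(0,0,0,12,13,14)$ denotes the Lie algebra with a basis $e_1,\dots,e_6$ whose dual basis satisfies $\mathrm{d}e^1=\mathrm{d}e^2=\mathrm{d}e^3=0$, $\mathrm{d}e^4=e^{12}$, $\mathrm{d}e^5=e^{13}$, $\mathrm{d}e^6=e^{14}$, where $e^{ij}=e^i\wedge e^j$ and $\mathrm{d}$ is the Chevalley–Eilenberg differential, $\mathrm{d}\alpha(X,Y)=-\alpha([X,Y])$; sums such as $14+23$ mean $e^{14}+e^{23}$. *)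

theory Defs
  imports "HOL-Analysis.Analysis"
begin

section \<open>Real Lie algebras\<close>

text \<open>A Lie algebra is a bracket on the vector space given by a type; it has dimension \<open>n > 0\<close>
  (in particular finite) when \<open>dim UNIV = n\<close>, since \<open>dim\<close> is \<open>0\<close> in the infinite-dimensional case.\<close>

definition lie_algebra :: "('a::real_vector \<Rightarrow> 'a \<Rightarrow> 'a) \<Rightarrow> bool" where
  "lie_algebra br \<longleftrightarrow> bilinear br \<and> (\<forall>x. br x x = 0) \<and>
     (\<forall>x y z. br x (br y z) + br y (br z x) + br z (br x y) = 0)"

definition abelian_lie :: "('a::real_vector \<Rightarrow> 'a \<Rightarrow> 'a) \<Rightarrow> bool" where
  "abelian_lie br \<longleftrightarrow> (\<forall>x y. br x y = 0)"

fun lower_central_series :: "('a::real_vector \<Rightarrow> 'a \<Rightarrow> 'a) \<Rightarrow> nat \<Rightarrow> 'a set" where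
  "lower_central_series br 0 = UNIV"
| "lower_central_series br (Suc n) = span {br x y | x y. y \<in> lower_central_series br n}"

definition nilpotent_lie :: "('a::real_vector \<Rightarrow> 'a \<Rightarrow> 'a) \<Rightarrow> bool" where
  "nilpotent_lie br \<longleftrightarrow> (\<exists>n. lower_central_series br n = {0})"

definition lie_subalgebra :: "('a::real_vector \<Rightarrow> 'a \<Rightarrow> 'a) \<Rightarrow> 'a set \<Rightarrow> bool" where
  "lie_subalgebra br S \<longleftrightarrow> subspace S \<and> (\<forall>x\<in>S. \<forall>y\<in>S. br x y \<in> S)"

definition lie_isomorphic ::
    "('a::real_vector \<Rightarrow> 'a \<Rightarrow> 'a) \<Rightarrow> ('b::real_vector \<Rightarrow> 'b \<Rightarrow> 'b) \<Rightarrow> bool" where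
  "lie_isomorphic br br' \<longleftrightarrow>
     (\<exists>\<phi>. linear \<phi> \<and> bij \<phi> \<and> (\<forall>x y. \<phi> (br x y) = br' (\<phi> x) (\<phi> y)))"

text \<open>The Chevalley--Eilenberg differential on one-forms and on two-forms.\<close>

definition ce_d1 :: "('a::real_vector \<Rightarrow> 'a \<Rightarrow> 'a) \<Rightarrow> ('a \<Rightarrow> real) \<Rightarrow> 'a \<Rightarrow> 'a \<Rightarrow> real" where
  "ce_d1 br \<alpha> x y = - \<alpha> (br x y)"

definition ce_d2 ::
    "('a::real_vector \<Rightarrow> 'a \<Rightarrow> 'a) \<Rightarrow> ('a \<Rightarrow> 'a \<Rightarrow> real) \<Rightarrow> 'a \<Rightarrow> 'a \<Rightarrow> 'a \<Rightarrow> real" where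
  "ce_d2 br \<omega> x y z = - \<omega> (br x y) z + \<omega> (br x z) y - \<omega> (br y z) x"

definition nijenhuis ::
    "('a::real_vector \<Rightarrow> 'a \<Rightarrow> 'a) \<Rightarrow> ('a \<Rightarrow> 'a) \<Rightarrow> 'a \<Rightarrow> 'a \<Rightarrow> 'a" where
  "nijenhuis br J x y = br (J x) (J y) - J (br (J x) y) - J (br x (J y)) + J (J (br x y))"


section \<open>Born structures\<close>

definition nondegenerate :: "('a::real_vector \<Rightarrow> 'a \<Rightarrow> real) \<Rightarrow> bool" where
  "nondegenerate b \<longleftrightarrow> (\<forall>x. (\<forall>y. b x y = 0) \<longrightarrow> x = 0)"

definition pseudo_metric :: "('a::real_vector \<Rightarrow> 'a \<Rightarrow> real) \<Rightarrow> bool" where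
  "pseudo_metric b \<longleftrightarrow> bilinear b \<and> (\<forall>x y. b x y = b y x) \<and> nondegenerate b"

definition two_form :: "('a::real_vector \<Rightarrow> 'a \<Rightarrow> real) \<Rightarrow> bool" where
  "two_form \<omega> \<longleftrightarrow> bilinear \<omega> \<and> (\<forall>x y. \<omega> x y = - \<omega> y x)"

definition recursion_operator ::
    "('a::real_vector \<Rightarrow> 'a \<Rightarrow> real) \<Rightarrow> ('a \<Rightarrow> 'a \<Rightarrow> real) \<Rightarrow> ('a \<Rightarrow> 'a) \<Rightarrow> bool" where
  "recursion_operator a b A \<longleftrightarrow> linear A \<and> bij A \<and> (\<forall>x y. a (A x) y = b x y)"

text \<open>The Born structure is the triple \<open>(g, h, \<omega>)\<close>; the recursion operators \<open>A\<close>, \<open>B\<close> and \<open>-J\<close>,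
  which it determines uniquely, are carried along as arguments.\<close>

definition born_structure ::
    "('a::real_vector \<Rightarrow> 'a \<Rightarrow> real) \<Rightarrow> ('a \<Rightarrow> 'a \<Rightarrow> real) \<Rightarrow> ('a \<Rightarrow> 'a \<Rightarrow> real) \<Rightarrow>
     ('a \<Rightarrow> 'a) \<Rightarrow> ('a \<Rightarrow> 'a) \<Rightarrow> ('a \<Rightarrow> 'a) \<Rightarrow> bool" where
  "born_structure g h \<omega> A B J \<longleftrightarrow>
     pseudo_metric g \<and> pseudo_metric h \<and> two_form \<omega> \<and> nondegenerate \<omega> \<and>
     recursion_operator g \<omega> A \<and> recursion_operator g h B \<and>
     recursion_operator \<omega> h (\<lambda>x. - J x) \<and>
     (\<forall>x. A (A x) = x) \<and> (\<forall>x. B (B x) = x) \<and> (\<forall>x. J (J x) = - x)"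

text \<open>\<open>(h, J, V\<^sub>+, V\<^sub>-)\<close> encodes a Born structure whose operator \<open>A\<close> has the
  \<open>\<plusminus>1\<close>-eigenspaces \<open>V\<^sub>\<plusminus>\<close>; see \<open>born_structure_encoding\<close> for the direct description.\<close>

definition integrable_born_structure ::
    "('a::real_vector \<Rightarrow> 'a \<Rightarrow> 'a) \<Rightarrow>
     ('a \<Rightarrow> 'a \<Rightarrow> real) \<Rightarrow> ('a \<Rightarrow> 'a) \<Rightarrow> 'a set \<Rightarrow> 'a set \<Rightarrow> bool" where
  "integrable_born_structure br h J Vp Vm \<longleftrightarrow>
     (\<exists>g \<omega> A B. born_structure g h \<omega> A B J \<and>
        Vp = {x. A x = x} \<and> Vm = {x. A x = - x} \<and>
        (\<forall>x y z. ce_d2 br \<omega> x y z = 0) \<and>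
        (\<forall>x y. nijenhuis br J x y = 0) \<and>
        lie_subalgebra br Vp \<and> lie_subalgebra br Vm)"

lemma recursion_operator_unique:
  assumes "bilinear a" "nondegenerate a" "recursion_operator a b A" "recursion_operator a b A'"
  shows "A = A'"
proof
  fix x
  have "a (A x - A' x) y = 0" for y
    using assms by (simp add: bilinear_lsub recursion_operator_def)
  then show "A x = A' x"
    using assms(2) unfolding nondegenerate_def by (metis right_minus_eq)
qed

lemma born_structure_encoding:
  "(\<exists>g \<omega> A B. born_structure g h \<omega> A B J \<and> Vp = {x. A x = x} \<and> Vm = {x. A x = - x}) \<longleftrightarrow>
   pseudo_metric h \<and> linear J \<and> (\<forall>x. J (J x) = - x) \<and> (\<forall>x y. h (J x) (J y) = h x y) \<and>
   subspace Vp \<and> subspace Vm \<and> Vp \<inter> Vm = {0} \<and> (\<forall>x. \<exists>u\<in>Vp. \<exists>v\<in>Vm. x = u + v) \<and>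
   (\<forall>u\<in>Vp. \<forall>v\<in>Vm. h u v = 0) \<and> J ` Vp = Vm \<and> J ` Vm = Vp"
  (is "?L \<longleftrightarrow> ?R")
proof
  assume ?L
  then obtain g \<omega> A B where b: "born_structure g h \<omega> A B J"
    and Vp: "Vp = {x. A x = x}" and Vm: "Vm = {x. A x = - x}" by blast
  have g: "bilinear g" "\<And>x y. g x y = g y x" "nondegenerate g" and h: "pseudo_metric h"
    and w: "bilinear \<omega>" "\<And>x y. \<omega> x y = - \<omega> y x" "nondegenerate \<omega>"
    and A: "linear A" "\<And>x y. g (A x) y = \<omega> x y" "\<And>x. A (A x) = x"
    and B: "linear B" "\<And>x y. g (B x) y = h x y" "\<And>x. B (B x) = x"
    and mJ: "linear (\<lambda>x. - J x)" "\<And>x y. \<omega> (- J x) y = h x y" and JJ: "\<And>x. J (J x) = - x"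
    using b unfolding born_structure_def pseudo_metric_def two_form_def recursion_operator_def by blast+
  have J: "linear J" using linear_compose_neg[OF mJ(1)] by simp
  have hw: "h x y = - \<omega> (J x) y" for x y
    using mJ(2)[of x y] by (simp add: bilinear_lneg[OF w(1)])
  have Beq: "B x = - A (J x)" for x
  proof -
    have "g (B x - - A (J x)) y = 0" for y
      using hw[of x y]
      by (simp add: bilinear_lsub[OF g(1)] bilinear_lneg[OF g(1)] bilinear_ladd[OF g(1)] A(2) B(2))
    then show ?thesis using g(3) unfolding nondegenerate_def by (metis right_minus_eq)
  qed
  have AJ: "A (J x) = - J (A x)" for x
  proof -
    have "A (J (A (J x))) = x"
      using B(3)[of x] by (simp add: Beq linear_neg[OF A(1)] linear_neg[OF J])
    then have "J (A (J x)) = A x" by (metis A(3))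
    then have "- A (J x) = J (A x)" by (metis JJ)
    then show ?thesis by (metis minus_minus)
  qed
  have hJ: "h (J x) (J y) = h x y" for x y
    using hw[of "J x" "J y"] hw[of y x] w(2)[of x "J y"] h
    by (simp add: JJ bilinear_lneg[OF w(1)] pseudo_metric_def)
  have wA: "\<omega> (A x) (A y) = - \<omega> x y" for x y
    using A(2)[of "A x" "A y"] A(2)[of y x] g(2)[of x "A y"] w(2)[of x y] by (simp add: A(3))
  have sp: "subspace Vp" "subspace Vm"
    unfolding Vp Vm subspace_def
    by (auto simp: linear_0[OF A(1)] linear_add[OF A(1)] linear_scale[OF A(1)])
  have int: "Vp \<inter> Vm = {0}"
  proof -
    have "x = - x \<Longrightarrow> x = 0" for x :: 'a
      by (metis add.right_inverse scaleR_2 scaleR_eq_0_iff zero_neq_numeral)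
    then show ?thesis unfolding Vp Vm by (auto simp: linear_0[OF A(1)])
  qed
  have split: "\<exists>u\<in>Vp. \<exists>v\<in>Vm. x = u + v" for x
  proof (intro bexI)
    show "x = (1/2) *\<^sub>R (x + A x) + (1/2) *\<^sub>R (x - A x)"
      by (simp add: algebra_simps flip: scaleR_add_left)
  qed (auto simp: Vp Vm linear_scale[OF A(1)] linear_add[OF A(1)] linear_diff[OF A(1)] A(3)
        algebra_simps)
  have JV: "J x \<in> Vm" if "x \<in> Vp" for x using that by (simp add: Vp Vm AJ)
  have JV': "J x \<in> Vp" if "x \<in> Vm" for x using that by (simp add: Vp Vm AJ linear_neg[OF J])
  have orth: "h u v = 0" if "u \<in> Vp" "v \<in> Vm" for u v
  proof -
    have "A (J u) = - J u" "A v = - v" using JV[OF that(1)] that(2) by (auto simp: Vm)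
    then show ?thesis
      using hw[of u v] wA[of "J u" v] by (simp add: bilinear_lneg[OF w(1)] bilinear_rneg[OF w(1)])
  qed
  have im1: "J ` Vp = Vm"
  proof
    show "Vm \<subseteq> J ` Vp"
    proof
      fix x assume "x \<in> Vm"
      then have "x = J (- J x)" "- J x \<in> Vp"
        using JV' subspace_neg[OF sp(1)] by (auto simp: linear_neg[OF J] JJ)
      then show "x \<in> J ` Vp" by blast
    qed
  qed (use JV in auto)
  have im2: "J ` Vm = Vp"
  proof
    show "Vp \<subseteq> J ` Vm"
    proof
      fix x assume "x \<in> Vp"
      then have "x = J (- J x)" "- J x \<in> Vm"
        using JV subspace_neg[OF sp(2)] by (auto simp: linear_neg[OF J] JJ)
      then show "x \<in> J ` Vm" by blast
    qed
  qed (use JV' in auto)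
  show ?R using h J JJ hJ sp int split orth im1 im2 by blast
next
  assume R: ?R
  then have h: "bilinear h" "\<And>x y. h x y = h y x" "nondegenerate h" and ph: "pseudo_metric h"
    and J: "linear J" and JJ: "\<And>x. J (J x) = - x" and hJ: "\<And>x y. h (J x) (J y) = h x y"
    and sp: "subspace Vp" "subspace Vm" and int: "Vp \<inter> Vm = {0}"
    and split: "\<And>x. \<exists>u\<in>Vp. \<exists>v\<in>Vm. x = u + v"
    and orth: "\<And>u v. u \<in> Vp \<Longrightarrow> v \<in> Vm \<Longrightarrow> h u v = 0"
    and im: "J ` Vp = Vm" "J ` Vm = Vp"
    by (simp_all only: pseudo_metric_def) simp_all
  have JV: "\<And>x. x \<in> Vp \<Longrightarrow> J x \<in> Vm" "\<And>x. x \<in> Vm \<Longrightarrow> J x \<in> Vp"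
    using im by blast+
  obtain p q where pq: "\<And>x. p x \<in> Vp" "\<And>x. q x \<in> Vm" "\<And>x. p x + q x = x"
    using split by metis
  have uniq: "p x = u \<and> q x = v" if "u \<in> Vp" "v \<in> Vm" "x = u + v" for x u v
  proof -
    have "p x + q x = u + v" using pq(3) that(3) by simp
    then have "p x - u = v - q x" by (simp add: algebra_simps)
    moreover have "p x - u \<in> Vp" "v - q x \<in> Vm"
      using sp pq that by (auto intro: subspace_diff)
    ultimately have "p x - u = 0" "v - q x = 0" using int by (metis IntI singletonD)+
    then show ?thesis by simp
  qed
  define A where "A x = p x - q x" for x
  have linA: "linear A"
  proof (rule linearI)
    show "A (x + y) = A x + A y" for x y
    proof -
      have "x + y = (p x + p y) + (q x + q y)"
      proof -
        have "(p x + p y) + (q x + q y) = (p x + q x) + (p y + q y)" by (simp add: ac_simps)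
        then show ?thesis by (simp only: pq(3))
      qed
      from uniq[OF subspace_add[OF sp(1) pq(1) pq(1)] subspace_add[OF sp(2) pq(2) pq(2)] this]
      show ?thesis by (simp add: A_def)
    qed
    show "A (c *\<^sub>R x) = c *\<^sub>R A x" for c x
    proof -
      have "c *\<^sub>R x = c *\<^sub>R p x + c *\<^sub>R q x" by (simp only: pq(3) flip: scaleR_add_right)
      from uniq[OF subspace_scale[OF sp(1) pq(1)] subspace_scale[OF sp(2) pq(2)] this]
      show ?thesis by (simp add: A_def scaleR_diff_right)
    qed
  qed
  have pA: "p (A x) = p x \<and> q (A x) = - q x" for x
    using uniq[OF pq(1) subspace_neg[OF sp(2) pq(2)], of "A x" x x] by (simp add: A_def)
  have AA: "A (A x) = x" for x using pA[of x] pq(3)[of x] by (simp add: A_def)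
  have pJ: "p (J x) = J (q x) \<and> q (J x) = J (p x)" for x
  proof (rule uniq)
    show "J x = J (q x) + J (p x)"
      by (simp only: pq(3) add.commute[of "q x"] flip: linear_add[OF J])
  qed (use JV pq in blast)+
  have AJ: "A (J x) = - J (A x)" for x
    using pJ[of x] by (simp add: A_def linear_diff[OF J])
  have hA: "h (A x) (A y) = h x y" for x y
  proof -
    have e: "h x y = h (p x + q x) (p y + q y)" using pq(3) by metis
    have "h (q x) (p y) = 0" "h (p x) (q y) = 0" using orth pq h(2) by metis+
    then show ?thesis
      by (simp add: A_def e bilinear_ladd[OF h(1)] bilinear_radd[OF h(1)]
          bilinear_lsub[OF h(1)] bilinear_rsub[OF h(1)])
  qed
  define \<omega> where "\<omega> x y = h (J x) y" for x y
  define g where "g x y = h (J (A x)) y" for x y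
  define B where "B x = - A (J x)" for x
  have bij: "bij f" if "\<And>x. f (f x) = x" for f :: "'a \<Rightarrow> 'a" using that by (rule involuntory_imp_bij)
  have linJ': "linear (\<lambda>x. - J x)" by (rule linear_compose_neg[OF J])
  have bJ: "bij (\<lambda>x. - J x)"
    by (rule o_bij[where g = J]) (auto simp: fun_eq_iff JJ linear_neg[OF J])
  have bw: "bilinear \<omega>"
    using h(1) linear_compose[OF J] unfolding bilinear_def \<omega>_def o_def by blast
  have bg: "bilinear g"
    using h(1) linear_compose[OF linear_compose[OF linA J]] unfolding bilinear_def g_def o_def by blast
  have J0: "J x = 0 \<Longrightarrow> x = 0" for x using JJ[of x] linear_0[OF J] by simp
  have A0: "A x = 0 \<Longrightarrow> x = 0" for x using AA[of x] linear_0[OF linA] by simp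
  have wskew: "\<omega> x y = - \<omega> y x" for x y
  proof -
    have "\<omega> x y = h (- x) (J y)" using hJ[of "J x" y] by (simp add: \<omega>_def JJ)
    also have "\<dots> = - h (J y) x" using h(2)[of x "J y"] by (simp only: bilinear_lneg[OF h(1)])
    finally show ?thesis by (simp add: \<omega>_def)
  qed
  have gsym: "g x y = g y x" for x y
  proof -
    have "g x y = - h (A (J x)) y"
      unfolding g_def by (simp only: AJ bilinear_lneg[OF h(1)] minus_minus)
    also have "h (A (J x)) y = h (J x) (A y)" using hA[of "J x" "A y"] by (simp only: AA)
    also have "- h (J x) (A y) = h (J (A y)) x"
      using wskew[of x "A y"] unfolding \<omega>_def by linarith
    finally show ?thesis unfolding g_def .
  qed
  have ndw: "nondegenerate \<omega>" using h(3) J0 unfolding nondegenerate_def \<omega>_def by blast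
  have ndg: "nondegenerate g" using h(3) J0 A0 unfolding nondegenerate_def g_def by blast
  have BB: "B (B x) = x" for x
    by (simp add: B_def AJ linear_neg[OF J] linear_neg[OF linA] AA JJ)
  have linB: "linear B"
    unfolding B_def using linear_compose_neg[OF linear_compose[OF J linA]] by (simp add: o_def)
  have pg: "pseudo_metric g" using bg gsym ndg unfolding pseudo_metric_def by blast
  have rA: "g (A x) y = \<omega> x y" for x y by (simp add: g_def \<omega>_def AA)
  have rB: "g (B x) y = h x y" for x y
    by (simp add: g_def B_def linear_neg[OF linA] linear_neg[OF J] AA JJ)
  have rJ: "\<omega> (- J x) y = h x y" for x y
    by (simp add: \<omega>_def linear_neg[OF J] JJ)
  have "born_structure g h \<omega> A B J"
    unfolding born_structure_def recursion_operator_def two_form_def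
    using ph pg bw ndw wskew linA linB linJ' bij[OF AA] bij[OF BB] bJ AA BB JJ rA rB rJ
    by blast
  moreover have "Vp = {x. A x = x}"
  proof (intro set_eqI iffI; simp)
    show "A x = x" if "x \<in> Vp" for x
      using uniq[OF that subspace_0[OF sp(2)], of x] by (simp add: A_def)
    show "x \<in> Vp" if "A x = x" for x
    proof -
      have "p x - q x = p x + q x" using that pq(3)[of x] by (simp add: A_def)
      then have "q x + q x = 0" by (simp add: algebra_simps)
      then have "2 *\<^sub>R q x = 0" by (simp add: scaleR_2)
      then show ?thesis using pq(1)[of x] pq(3)[of x] by auto
    qed
  qed
  moreover have "Vm = {x. A x = - x}"
  proof (intro set_eqI iffI; simp)
    show "A x = - x" if "x \<in> Vm" for x
      using uniq[OF subspace_0[OF sp(1)] that, of x] by (simp add: A_def)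
    show "x \<in> Vm" if "A x = - x" for x
    proof -
      have "p x - q x = - (p x + q x)" using that pq(3)[of x] by (simp add: A_def)
      then have "p x = - p x" by (simp add: algebra_simps)
      then have "p x + p x = 0" by (metis add.right_inverse)
      then have "2 *\<^sub>R p x = 0" by (simp add: scaleR_2)
      then show ?thesis using pq(2)[of x] pq(3)[of x] by auto
    qed
  qed
  ultimately show ?L by blast
qed


section \<open>Six-dimensional Lie algebras in Salamon's notation\<close>

text \<open>The standard basis of \<open>real^6\<close> is \<open>axis 1 1, \<dots>, axis 6 1\<close>, with dual basis \<open>\<lambda>x. x $ k\<close>; in
  the index type \<open>6\<close> the numeral \<open>6\<close> equals \<open>0\<close>, so \<open>1, \<dots>, 6\<close> are exactly its six elements.
  A list of index pairs stands for the sum of the corresponding \<open>e\<^sup>i \<and> e\<^sup>j\<close>.\<close>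

definition sum_wedge :: "(6 \<times> 6) list \<Rightarrow> real^6 \<Rightarrow> real^6 \<Rightarrow> real" where
  "sum_wedge ps x y = (\<Sum>(i, j)\<leftarrow>ps. x $ i * y $ j - x $ j * y $ i)"

definition salamon :: "(6 \<times> 6) list \<Rightarrow> (6 \<times> 6) list \<Rightarrow> (6 \<times> 6) list \<Rightarrow> (6 \<times> 6) list \<Rightarrow>
    (6 \<times> 6) list \<Rightarrow> (6 \<times> 6) list \<Rightarrow> real^6 \<Rightarrow> real^6 \<Rightarrow> real^6" where
  "salamon d1 d2 d3 d4 d5 d6 x y =
     - (sum_wedge d1 x y *\<^sub>R axis 1 1 + sum_wedge d2 x y *\<^sub>R axis 2 1 +
        sum_wedge d3 x y *\<^sub>R axis 3 1 + sum_wedge d4 x y *\<^sub>R axis 4 1 +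
        sum_wedge d5 x y *\<^sub>R axis 5 1 + sum_wedge d6 x y *\<^sub>R axis 6 1)"

definition h4 :: "real^6 \<Rightarrow> real^6 \<Rightarrow> real^6" where
  "h4 = salamon [] [] [] [] [(1,2)] [(1,4),(2,3)]"

definition h7 :: "real^6 \<Rightarrow> real^6 \<Rightarrow> real^6" where
  "h7 = salamon [] [] [] [(1,2)] [(1,3)] [(2,3)]"

definition h8 :: "real^6 \<Rightarrow> real^6 \<Rightarrow> real^6" where
  "h8 = salamon [] [] [] [] [] [(1,2)]"

definition h9 :: "real^6 \<Rightarrow> real^6 \<Rightarrow> real^6" where
  "h9 = salamon [] [] [] [] [(1,2)] [(1,4),(2,5)]"

definition h10 :: "real^6 \<Rightarrow> real^6 \<Rightarrow> real^6" where
  "h10 = salamon [] [] [] [(1,2)] [(1,3)] [(1,4)]"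

definition h11 :: "real^6 \<Rightarrow> real^6 \<Rightarrow> real^6" where
  "h11 = salamon [] [] [] [(1,2)] [(1,3)] [(1,4),(2,3)]"

definition h13 :: "real^6 \<Rightarrow> real^6 \<Rightarrow> real^6" where
  "h13 = salamon [] [] [] [(1,2)] [(1,3),(1,4)] [(2,4)]"

lemma exhaust_6: "x = 1 \<or> x = 2 \<or> x = 3 \<or> x = 4 \<or> x = 5 \<or> x = 6" for x :: 6
proof (induct x)
  case (of_int z)
  then have "z = 0 \<or> z = 1 \<or> z = 2 \<or> z = 3 \<or> z = 4 \<or> z = 5" by fastforce
  then show ?case by auto
qed

lemma forall_6: "(\<forall>i::6. P i) \<longleftrightarrow> P 1 \<and> P 2 \<and> P 3 \<and> P 4 \<and> P 5 \<and> P 6"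
  by (metis exhaust_6)

lemma salamon_nth:
  "salamon d1 d2 d3 d4 d5 d6 x y $ 1 = - sum_wedge d1 x y"
  "salamon d1 d2 d3 d4 d5 d6 x y $ 2 = - sum_wedge d2 x y"
  "salamon d1 d2 d3 d4 d5 d6 x y $ 3 = - sum_wedge d3 x y"
  "salamon d1 d2 d3 d4 d5 d6 x y $ 4 = - sum_wedge d4 x y"
  "salamon d1 d2 d3 d4 d5 d6 x y $ 5 = - sum_wedge d5 x y"
  "salamon d1 d2 d3 d4 d5 d6 x y $ 6 = - sum_wedge d6 x y"
  by (simp_all add: salamon_def axis_def)

lemma salamon_structure_equations:
  "ce_d1 (salamon d1 d2 d3 d4 d5 d6) (\<lambda>v. v $ 1) = sum_wedge d1"
  "ce_d1 (salamon d1 d2 d3 d4 d5 d6) (\<lambda>v. v $ 2) = sum_wedge d2"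
  "ce_d1 (salamon d1 d2 d3 d4 d5 d6) (\<lambda>v. v $ 3) = sum_wedge d3"
  "ce_d1 (salamon d1 d2 d3 d4 d5 d6) (\<lambda>v. v $ 4) = sum_wedge d4"
  "ce_d1 (salamon d1 d2 d3 d4 d5 d6) (\<lambda>v. v $ 5) = sum_wedge d5"
  "ce_d1 (salamon d1 d2 d3 d4 d5 d6) (\<lambda>v. v $ 6) = sum_wedge d6"
  by (simp_all add: fun_eq_iff ce_d1_def salamon_nth)

lemma lie_algebra_list:
  "lie_algebra h4" "lie_algebra h7" "lie_algebra h8" "lie_algebra h9"
  "lie_algebra h10" "lie_algebra h11" "lie_algebra h13"
  by (simp_all add: lie_algebra_def bilinear_def linear_iff vec_eq_iff forall_6 salamon_nth
      sum_wedge_def h4_def h7_def h8_def h9_def h10_def h11_def h13_def algebra_simps)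

end

theory Submission
  imports Defs
begin

text \<open>
  Let \<open>V\<close> be the \<open>+1\<close>-eigenspace of \<open>A\<close>, so that \<open>\<gg> = V \<oplus> JV\<close>. The mixed brackets define two
  products on \<open>V\<close> by \<open>[x, Jz] = J (D x z) - D' z x\<close>. Vanishing of the Nijenhuis tensor says that
  both are torsion free, that is \<open>[x, y] = D x y - D y x\<close> and \<open>[Jx, Jy] = J (D' x y - D' y x)\<close>;
  closedness of \<open>\<omega>\<close> says that \<open>h (D x y) z + h y (D x z)\<close> is totally symmetric, and likewise for
  \<open>D'\<close>; the Jacobi identity says that both are flat, together with a compatibility between the
  two. Hence an integrable Born structure amounts to two compatible left-invariant Hessian structures on the
  three-dimensional pseudo-Euclidean space \<open>(V, h)\<close>, and nilpotency of \<open>\<gg>\<close> makes the operators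
  \<open>D x\<close>, and the operators \<open>D' x\<close>, simultaneously strictly triangular.

  Such a Hessian structure is very rigid. Orthogonalising a triangular flag as far as the
  indefinite metric permits, one sees that a nonzero \<open>D\<close> possesses a null vector \<open>e\<close> for which
  \<open>\<langle>e\<rangle> \<subseteq> e\<^sup>\<bottom> \<subseteq> V\<close> is a triangular flag (\<open>adapted_exists\<close>; in the definite case \<open>D\<close> must therefore
  vanish). In a frame \<open>e, u, f\<close> with \<open>h e f = h u u\<close> as the only nonzero products, symmetry and
  flatness leave three parameters: \<open>D u f = r e\<close>, \<open>D f u = t e\<close>, \<open>D f f = w e + (2r - t) u\<close>
  (\<open>adapted_normal_form\<close>). The null lines of \<open>D\<close> and \<open>D'\<close> must agree, since the compatibility
  kills one of two products with transverse null lines (\<open>transverse_trivial\<close>). So \<open>\<gg>\<close> belongs to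
  a family \<open>born_model\<close> with six real parameters (\<open>isomorphic_to_model\<close>), and conversely each
  member of the family carries a Born structure (\<open>born_model_integrable\<close>).

  It remains to sort the family. Combining the parameters into \<open>r + i r'\<close>, \<open>q + i q'\<close>,
  \<open>w + i w'\<close> with \<open>q = 2r - t\<close> and \<open>q' = 2r' - t'\<close>, a rotation in the planes \<open>\<langle>x, Jx\<rangle>\<close> multiplies
  these complex numbers by a common phase (\<open>model_rotate\<close>). After making \<open>q\<close> real, which
  of the parameters and of the differences \<open>r - q\<close>, \<open>2r - q\<close> vanish decides between the seven
  algebras (\<open>model_classification\<close>), and each of the seven occurs.
\<close>

section \<open>Isomorphisms and transport of Born structures\<close>

lemma lie_isomorphic_sym:
  assumes "lie_isomorphic br br'" shows "lie_isomorphic br' br"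
proof -
  obtain \<phi> where p: "linear \<phi>" "bij \<phi>" "\<And>x y. \<phi> (br x y) = br' (\<phi> x) (\<phi> y)"
    using assms unfolding lie_isomorphic_def by blast
  have i: "inv \<phi> (\<phi> x) = x" "\<phi> (inv \<phi> y) = y" for x y
    using p(2) by (simp_all add: bij_is_inj bij_is_surj surj_f_inv_f)
  have "linear (inv \<phi>)"
    by (rule linearI) (metis i linear_add[OF p(1)], metis i linear_scale[OF p(1)])
  moreover have "bij (inv \<phi>)" using p(2) by (rule bij_imp_bij_inv)
  moreover have "inv \<phi> (br' x y) = br (inv \<phi> x) (inv \<phi> y)" for x y
    by (metis i p(3))
  ultimately show ?thesis unfolding lie_isomorphic_def by blast
qed

lemma lie_isomorphic_trans:
  assumes "lie_isomorphic br br'" "lie_isomorphic br' br''" shows "lie_isomorphic br br''"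
proof -
  obtain f g where "linear f" "bij f" "\<And>x y. f (br x y) = br' (f x) (f y)"
    "linear g" "bij g" "\<And>x y. g (br' x y) = br'' (g x) (g y)"
    using assms unfolding lie_isomorphic_def by blast
  then have "linear (g \<circ> f)" "bij (g \<circ> f)" "\<And>x y. (g \<circ> f) (br x y) = br'' ((g \<circ> f) x) ((g \<circ> f) y)"
    by (auto intro: linear_compose bij_comp)
  then show ?thesis unfolding lie_isomorphic_def by blast
qed

lemma abelian_lie_isomorphic:
  assumes "lie_isomorphic br br'" "abelian_lie br'" shows "abelian_lie br"
  using assms unfolding lie_isomorphic_def abelian_lie_def
  by (metis (no_types, lifting) bij_is_inj injD linear_0)

text \<open>Since \<open>\<omega>\<close> is necessarily \<open>h (J \<cdot>) \<cdot>\<close>, integrability can be expressed through \<open>(h, J, V\<^sub>+, V\<^sub>-)\<close>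
  alone; this is the form in which Born structures are constructed, transported and analysed.\<close>

lemma integrable_born_structure_encoding:
  "integrable_born_structure br h J Vp Vm \<longleftrightarrow>
   (pseudo_metric h \<and> linear J \<and> (\<forall>x. J (J x) = - x) \<and> (\<forall>x y. h (J x) (J y) = h x y) \<and>
   subspace Vp \<and> subspace Vm \<and> Vp \<inter> Vm = {0} \<and> (\<forall>x. \<exists>u\<in>Vp. \<exists>v\<in>Vm. x = u + v) \<and>
   (\<forall>u\<in>Vp. \<forall>v\<in>Vm. h u v = 0) \<and> J ` Vp = Vm \<and> J ` Vm = Vp) \<and>
   (\<forall>x y z. ce_d2 br (\<lambda>a b. h (J a) b) x y z = 0) \<and> (\<forall>x y. nijenhuis br J x y = 0) \<and>
   lie_subalgebra br Vp \<and> lie_subalgebra br Vm"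
proof -
  have w: "\<omega> = (\<lambda>a b. h (J a) b)" if b: "born_structure g h \<omega> A B J" for g \<omega> A B
  proof (intro ext)
    fix a b
    have r: "\<omega> (- J x) y = h x y" "J (J x) = - x" for x y
      using b unfolding born_structure_def recursion_operator_def by simp_all
    show "\<omega> a b = h (J a) b" using r(1)[of "J a" b] by (simp only: r(2) minus_minus)
  qed
  have E: "\<And>P Q. (\<exists>g \<omega> A B. born_structure g h \<omega> A B J \<and> Vp = {x. A x = x} \<and> Vm = {x. A x = - x}) = P \<Longrightarrow>
    (Q = ((\<exists>g \<omega> A B. born_structure g h \<omega> A B J \<and> Vp = {x. A x = x} \<and> Vm = {x. A x = - x}) \<and> R)) \<Longrightarrow> (Q = (P \<and> R))" for R
    by simp
  show ?thesis
  proof (rule E[OF born_structure_encoding], intro iffI)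
    assume "integrable_born_structure br h J Vp Vm"
    then obtain g \<omega> A B where b: "born_structure g h \<omega> A B J" and V: "Vp = {x. A x = x}" "Vm = {x. A x = - x}"
      and c: "\<forall>x y z. ce_d2 br \<omega> x y z = 0" and n: "\<forall>x y. nijenhuis br J x y = 0"
        "lie_subalgebra br Vp" "lie_subalgebra br Vm"
      unfolding integrable_born_structure_def by (elim exE conjE)
    have "\<forall>x y z. ce_d2 br (\<lambda>a b. h (J a) b) x y z = 0" using c unfolding w[OF b] .
    moreover have "\<exists>g \<omega> A B. born_structure g h \<omega> A B J \<and> Vp = {x. A x = x} \<and> Vm = {x. A x = - x}"
      using b V by (intro exI conjI)
    ultimately show "(\<exists>g \<omega> A B. born_structure g h \<omega> A B J \<and> Vp = {x. A x = x} \<and> Vm = {x. A x = - x}) \<and>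
      (\<forall>x y z. ce_d2 br (\<lambda>a b. h (J a) b) x y z = 0) \<and> (\<forall>x y. nijenhuis br J x y = 0) \<and>
      lie_subalgebra br Vp \<and> lie_subalgebra br Vm"
      using n by (intro conjI)
  next
    assume "(\<exists>g \<omega> A B. born_structure g h \<omega> A B J \<and> Vp = {x. A x = x} \<and> Vm = {x. A x = - x}) \<and>
      (\<forall>x y z. ce_d2 br (\<lambda>a b. h (J a) b) x y z = 0) \<and> (\<forall>x y. nijenhuis br J x y = 0) \<and>
      lie_subalgebra br Vp \<and> lie_subalgebra br Vm"
    then obtain g \<omega> A B where b: "born_structure g h \<omega> A B J" and V: "Vp = {x. A x = x}" "Vm = {x. A x = - x}"
      and c: "\<forall>x y z. ce_d2 br (\<lambda>a b. h (J a) b) x y z = 0" and n: "\<forall>x y. nijenhuis br J x y = 0"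
        "lie_subalgebra br Vp" "lie_subalgebra br Vm"
      by (elim exE conjE)
    have "\<forall>x y z. ce_d2 br \<omega> x y z = 0" using c unfolding w[OF b] .
    then show "integrable_born_structure br h J Vp Vm"
      unfolding integrable_born_structure_def using b V n by (intro exI conjI)
  qed
qed

lemma integrable_born_structure_transport:
  assumes "lie_isomorphic br br'" "integrable_born_structure br' h J Vp Vm"
  shows "\<exists>h J Vp Vm. integrable_born_structure br h J Vp Vm"
proof -
  obtain f where f: "linear f" "bij f" "\<And>x y. f (br x y) = br' (f x) (f y)"
    using assms(1) unfolding lie_isomorphic_def by blast
  define k where "k = inv f"
  have i [simp]: "k (f x) = x" "f (k y) = y" for x y
    using f(2) by (simp_all add: k_def bij_is_inj bij_is_surj surj_f_inv_f)
  have lk: "linear k"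
    by (rule linearI) (metis i linear_add[OF f(1)], metis i linear_scale[OF f(1)])
  have brk: "br x y = k (br' (f x) (f y))" for x y by (metis i(1) f(3))
  note lin = linear_add[OF f(1)] linear_scale[OF f(1)] linear_neg[OF f(1)] linear_0[OF f(1)]
    linear_add[OF lk] linear_scale[OF lk] linear_neg[OF lk] linear_0[OF lk] linear_diff[OF lk]
  have B: "pseudo_metric h" "linear J" "\<And>x. J (J x) = - x" "\<And>x y. h (J x) (J y) = h x y"
   "subspace Vp" "subspace Vm" "Vp \<inter> Vm = {0}" "\<And>x. \<exists>u\<in>Vp. \<exists>v\<in>Vm. x = u + v"
   "\<And>u v. u\<in>Vp \<Longrightarrow> v\<in>Vm \<Longrightarrow> h u v = 0" "J ` Vp = Vm" "J ` Vm = Vp"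
   "\<And>x y z. ce_d2 br' (\<lambda>a b. h (J a) b) x y z = 0" "\<And>x y. nijenhuis br' J x y = 0"
   "lie_subalgebra br' Vp" "lie_subalgebra br' Vm"
    using assms(2) unfolding integrable_born_structure_encoding by simp_all
  define h' where "h' x y = h (f x) (f y)" for x y
  define J' where "J' x = k (J (f x))" for x
  have img: "J' ` (k ` S) = k ` (J ` S)" for S by (auto simp: J'_def image_image)
  have mem: "x \<in> k ` S \<longleftrightarrow> f x \<in> S" for x S by (metis i image_iff)
  have h: "bilinear h" "\<And>x y. h x y = h y x" "nondegenerate h" using B(1) by (auto simp: pseudo_metric_def)
  have 1: "pseudo_metric h'"
    unfolding pseudo_metric_def
  proof (intro conjI allI)
    show "bilinear h'" unfolding bilinear_def h'_def
      by (auto intro!: linearI simp: lin bilinear_ladd[OF h(1)] bilinear_radd[OF h(1)]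
          bilinear_lmul[OF h(1)] bilinear_rmul[OF h(1)])
    show "h' x y = h' y x" for x y by (simp add: h'_def h(2)[of "f x"])
    show "nondegenerate h'" unfolding nondegenerate_def
    proof (intro allI impI)
      fix x assume "\<forall>y. h' x y = 0"
      then have "h (f x) y = 0" for y by (metis h'_def i(2))
      then have "f x = 0" using h(3) by (auto simp: nondegenerate_def)
      then show "x = 0" by (metis i(1) lin(8))
    qed
  qed
  have 2: "linear J'" unfolding J'_def
    by (rule linearI) (simp_all add: lin linear_add[OF B(2)] linear_scale[OF B(2)])
  have 3: "J' (J' x) = - x" "h' (J' x) (J' y) = h' x y" for x y
    by (simp_all add: J'_def h'_def B lin)
  have 4: "subspace (k ` Vp)" "subspace (k ` Vm)" by (simp_all add: B lk linear_subspace_image)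
  have 5: "k ` Vp \<inter> k ` Vm = {0}"
  proof -
    have "inj k" by (metis i(2) injI)
    then have "k ` Vp \<inter> k ` Vm = k ` (Vp \<inter> Vm)" by (simp add: image_Int)
    then show ?thesis by (simp add: B lin)
  qed
  have 6: "\<exists>u\<in>k`Vp. \<exists>v\<in>k`Vm. x = u + v" for x
    using B(8)[of "f x"] by (metis i(1) image_eqI lin(5))
  have 7: "h' u v = 0" if "u \<in> k ` Vp" "v \<in> k ` Vm" for u v
    using that B(9) by (auto simp: h'_def)
  have 8: "J' ` (k ` Vp) = k ` Vm" "J' ` (k ` Vm) = k ` Vp" by (simp_all only: img B)
  have 9: "ce_d2 br (\<lambda>a b. h' (J' a) b) x y z = 0" for x y z
    using B(12)[of "f x" "f y" "f z"] by (simp add: ce_d2_def brk h'_def J'_def)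
  have 10: "nijenhuis br J' x y = 0" for x y
  proof -
    have "nijenhuis br J' x y = k (nijenhuis br' J (f x) (f y))"
      by (simp add: nijenhuis_def brk J'_def lin)
    then show ?thesis by (simp add: B lin)
  qed
  have 11: "lie_subalgebra br (k ` Vp)" "lie_subalgebra br (k ` Vm)"
    using B(14,15) 4 by (auto simp: lie_subalgebra_def brk)
  have "integrable_born_structure br h' J' (k ` Vp) (k ` Vm)"
    unfolding integrable_born_structure_encoding
    by (intro conjI allI ballI) (rule 1 2 3 4 5 6 7 8 9 10 11; assumption?)+
  then show ?thesis by blast
qed

section \<open>The model algebras\<close>

text \<open>Coordinates \<open>1, \<dots>, 6\<close> of a model algebra refer to a basis \<open>X, Y, U, P, E, Z\<close>; the complex structure
  sends \<open>X\<close> to \<open>Y\<close>, \<open>U\<close> to \<open>P\<close> and \<open>E\<close> to \<open>Z\<close>.\<close>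

definition vec6 :: "real \<Rightarrow> real \<Rightarrow> real \<Rightarrow> real \<Rightarrow> real \<Rightarrow> real \<Rightarrow> real^6" where
  "vec6 a b c d e f = (\<chi> i. if i = 1 then a else if i = 2 then b else if i = 3 then c
     else if i = 4 then d else if i = 5 then e else f)"

lemma vec6_nth [simp]:
  "vec6 a b c d e f $ 1 = a" "vec6 a b c d e f $ 2 = b" "vec6 a b c d e f $ 3 = c"
  "vec6 a b c d e f $ 4 = d" "vec6 a b c d e f $ 5 = e" "vec6 a b c d e f $ 6 = f"
  by (simp_all add: vec6_def)

text \<open>The brackets are
  \<open>[X, Y] = q P - q' U + w Z - w' E\<close>, \<open>[X, U] = (r - q) E\<close>, \<open>[X, P] = (2r - q) Z - r' E\<close>,
  \<open>[Y, U] = (2r' - q') E - r Z\<close> and \<open>[Y, P] = (r' - q') Z\<close>. They arise from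
  \<open>(X, Y, U, P, E, Z) = (f, Jf, u, Ju, e, Je)\<close> when both products on \<open>V\<close> are in normal form with
  respect to the null frame \<open>e, u, f\<close>.\<close>

definition born_model :: "real \<Rightarrow> real \<Rightarrow> real \<Rightarrow> real \<Rightarrow> real \<Rightarrow> real \<Rightarrow> real^6 \<Rightarrow> real^6 \<Rightarrow> real^6" where
  "born_model r q w r' q' w' x y =
    (let m = \<lambda>i j. x $ i * y $ j - x $ j * y $ i in
      vec6 0 0 (- q' * m 1 2) (q * m 1 2)
        ((r - q) * m 1 3 - r' * m 1 4 + (2 * r' - q') * m 2 3 - w' * m 1 2)
        ((2 * r - q) * m 1 4 - r * m 2 3 + (r' - q') * m 2 4 + w * m 1 2))"

text \<open>The columns of \<open>\<psi>\<close> are vectors of the first algebra that satisfy the structure equations of the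
  second one. Comparing coordinates is then a polynomial identity.\<close>

lemma lie_isomorphic_by_coordinates:
  fixes br br' :: "real^6 \<Rightarrow> real^6 \<Rightarrow> real^6"
  assumes "linear \<psi>" "\<And>x. \<psi> x = 0 \<Longrightarrow> x = 0" "\<And>x y. \<psi> (br' x y) = br (\<psi> x) (\<psi> y)"
  shows "lie_isomorphic br br'"
proof -
  have "inj \<psi>" using assms(1,2) linear_injective_0 by blast
  then have "bij \<psi>"
    using linear_injective_imp_surjective[OF assms(1)] by (simp add: bij_def)
  then show ?thesis using assms(1,3) lie_isomorphic_sym unfolding lie_isomorphic_def by blast
qed

lemmas coord_simps = linear_iff vec_eq_iff forall_6 born_model_def Let_def salamon_nth sum_wedge_def
  h4_def h7_def h8_def h9_def h10_def h11_def h13_def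

text \<open>The change of basis multiplies each of the planes \<open>\<langle>X, Y\<rangle>\<close>, \<open>\<langle>U, P\<rangle>\<close>, \<open>\<langle>E, Z\<rangle>\<close> by \<open>c + i s\<close>. The
  brackets are equivariant once the parameters are multiplied by \<open>c - i s\<close>. All relations are
  homogeneous, so that \<open>c\<^sup>2 + s\<^sup>2 = 1\<close> is not imposed and no square roots arise.\<close>

lemma model_rotate:
  assumes "c \<noteq> 0 \<or> s \<noteq> 0"
  shows "lie_isomorphic (born_model r q w r' q' w')
    (born_model (c * r + s * r') (c * q + s * q') (c * w + s * w')
       (c * r' - s * r) (c * q' - s * q) (c * w' - s * w))"
proof (rule lie_isomorphic_by_coordinates)
  let ?f = "\<lambda>x::real^6. vec6 (c * x$1 - s * x$2) (s * x$1 + c * x$2) (c * x$3 - s * x$4)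
    (s * x$3 + c * x$4) (c * x$5 - s * x$6) (s * x$5 + c * x$6)"
  show "linear ?f" by (simp add: coord_simps algebra_simps)
  have z: "a = 0 \<and> b = 0" if "c * a = s * b" "s * a + c * b = 0" for a b
  proof -
    have "(c^2 + s^2) * a = 0" "(c^2 + s^2) * b = 0" using that by algebra+
    then show ?thesis using assms by (auto simp: sum_power2_eq_zero_iff)
  qed
  show "x = 0" if "?f x = 0" for x
    using that z[of "x$1" "x$2"] z[of "x$3" "x$4"] z[of "x$5" "x$6"] by (simp add: coord_simps)
  show "?f (born_model (c * r + s * r') (c * q + s * q') (c * w + s * w')
       (c * r' - s * r) (c * q' - s * q) (c * w' - s * w) x y) = born_model r q w r' q' w' (?f x) (?f y)" for x y
    by (simp add: coord_simps) (simp add: algebra_simps)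
qed

text \<open>In this and the next three cases \<open>q \<noteq> 0\<close> makes the algebra generated by \<open>X, Y, U\<close> modulo central
  vectors: \<open>[X, Y]\<close> plays the part of \<open>P\<close>, and the first two basis vectors are \<open>X\<close> and \<open>Y\<close>
  up to order and scale.\<close>

lemma model_h10:
  assumes "q \<noteq> 0" shows "lie_isomorphic (born_model 0 q w 0 0 w') h10"
proof (rule lie_isomorphic_by_coordinates)
  let ?f = "\<lambda>x::real^6. vec6 (x$1) (x$2) (x$3) (- q * x$4) (w' * x$4 + q * x$5) (- w * x$4 - q^2 * x$6)"
  show "linear ?f" by (simp add: coord_simps algebra_simps)
  show "x = 0" if "?f x = 0" for x using that assms by (auto simp: coord_simps)
  show "?f (h10 x y) = born_model 0 q w 0 0 w' (?f x) (?f y)" for x y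
    by (simp add: coord_simps algebra_simps power2_eq_square)
qed

lemma model_h11:
  assumes "q \<noteq> 0" "r \<noteq> 0" "r \<noteq> q" "2 * r \<noteq> q" shows "lie_isomorphic (born_model r q w 0 0 w') h11"
proof (rule lie_isomorphic_by_coordinates)
  define k where "k = q * (2 * r - q)"
  have k: "k \<noteq> 0" using assms by (simp add: k_def)
  let ?f = "\<lambda>x::real^6. vec6 (r * x$1) (x$2) (r * k * x$3) (- r * q * x$4)
    (r * w' * x$4 - r^2 * k * (r - q) * x$5) (- r * w * x$4 + r^2 * k * x$6)"
  show "linear ?f" by (simp add: coord_simps algebra_simps)
  show "x = 0" if "?f x = 0" for x using that assms k by (auto simp: coord_simps)
  show "?f (h11 x y) = born_model r q w 0 0 w' (?f x) (?f y)" for x y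
    by (simp add: coord_simps k_def) (simp add: algebra_simps power2_eq_square)
qed

lemma model_h9:
  assumes "q \<noteq> 0" shows "lie_isomorphic (born_model q q w 0 0 w') h9"
proof (rule lie_isomorphic_by_coordinates)
  let ?f = "\<lambda>x::real^6. vec6 (x$2) (x$1) (- q * x$4) (q * x$5) (x$3 - w' * x$5) (w * x$5 - q^2 * x$6)"
  show "linear ?f" by (simp add: coord_simps algebra_simps)
  show "x = 0" if "?f x = 0" for x using that assms by (auto simp: coord_simps)
  show "?f (h9 x y) = born_model q q w 0 0 w' (?f x) (?f y)" for x y
    by (simp add: coord_simps algebra_simps power2_eq_square)
qed

lemma model_h7:
  assumes "r \<noteq> 0" shows "lie_isomorphic (born_model r (2 * r) w 0 0 w') h7"
proof (rule lie_isomorphic_by_coordinates)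
  let ?f = "\<lambda>x::real^6. vec6 (x$1) (x$2) (x$3) (- 2 * r * x$4) (w' * x$4 + r * x$5) (- w * x$4 + r * x$6)"
  show "linear ?f" by (simp add: coord_simps algebra_simps)
  show "x = 0" if "?f x = 0" for x using that assms by (auto simp: coord_simps)
  show "?f (h7 x y) = born_model r (2 * r) w 0 0 w' (?f x) (?f y)" for x y
    by (simp add: coord_simps algebra_simps)
qed

text \<open>The third basis vector is \<open>Y\<close> corrected by a combination of \<open>U\<close> and \<open>P\<close> so as to commute with \<open>X\<close>.\<close>

lemma model_h4:
  assumes "r \<noteq> 0" shows "lie_isomorphic (born_model r 0 w 0 0 w') h4"
proof (rule lie_isomorphic_by_coordinates)
  let ?f = "\<lambda>x::real^6. vec6 (x$1) (x$3) (x$2 + w' / r * x$3) (x$4 / 2 - w / (2 * r) * x$3)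
     (- r * x$5) (- r * x$6)"
  show "linear ?f" by (simp add: coord_simps algebra_simps add_divide_distrib)
  show "x = 0" if "?f x = 0" for x using that assms by (auto simp: coord_simps)
  show "?f (h4 x y) = born_model r 0 w 0 0 w' (?f x) (?f y)" for x y
    using assms by (simp add: coord_simps field_simps)
qed

lemma model_h8:
  assumes "w \<noteq> 0 \<or> w' \<noteq> 0" shows "lie_isomorphic (born_model 0 0 w 0 0 w') h8"
proof (rule lie_isomorphic_by_coordinates)
  let ?f = "\<lambda>x::real^6. vec6 (x$1) (x$2) (x$3) (x$4) (w * x$5 + w' * x$6) (w' * x$5 - w * x$6)"
  show "linear ?f" by (simp add: coord_simps algebra_simps)
  have z: "a = 0 \<and> b = 0" if "w * a + w' * b = 0" "w' * a = w * b" for a b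
  proof -
    have "(w^2 + w'^2) * a = 0" "(w^2 + w'^2) * b = 0" using that by algebra+
    then show ?thesis using assms by (auto simp: sum_power2_eq_zero_iff)
  qed
  show "x = 0" if "?f x = 0" for x
    using that z[of "x$5" "x$6"] by (simp add: coord_simps)
  show "?f (h8 x y) = born_model 0 0 w 0 0 w' (?f x) (?f y)" for x y
    by (simp add: coord_simps algebra_simps)
qed

text \<open>Put \<open>Q = [X, Y]\<close>. Both \<open>U\<close> and \<open>Q\<close> map the plane \<open>\<langle>X, Y\<rangle>\<close> to \<open>\<langle>E, Z\<rangle>\<close> by bracketing, \<open>Q\<close> bijectively.
  The characteristic polynomial of \<open>ad\<^sub>U\<close> relative to \<open>ad\<^sub>Q\<close> always splits: its roots \<open>r / (q r')\<close> and
  \<open>(r - q) / (q r')\<close> differ by \<open>1 / r'\<close>, with eigenvectors \<open>2r' X - (2r - q) Y\<close> and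
  \<open>r' X - (r - q) Y\<close>. These are the first two basis vectors; the third one is a combination of \<open>U\<close>
  and \<open>Q\<close> that annihilates the second.\<close>

lemma model_h13:
  assumes "q \<noteq> 0" "r' \<noteq> 0" shows "lie_isomorphic (born_model r q w r' 0 w') h13"
proof (rule lie_isomorphic_by_coordinates)
  define a where "a = r'^2 * q^2"
  define b where "b = r' * (r - q)"
  have a0: "a \<noteq> 0" using assms by (simp add: a_def)
  let ?f = "\<lambda>x::real^6. vec6 (2 * r' * x$1 + r' * x$2) (- (2 * r - q) * x$1 - (r - q) * x$2)
     (- (r'^2 * q) * x$3) (q * (b * x$3 - r' * q * x$4))
     (- w' * (b * x$3 - r' * q * x$4) - 2 * r' * a * x$5 - r' * a * x$6)
     (w * (b * x$3 - r' * q * x$4) + (2 * r - q) * a * x$5 + r * a * x$6)"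
  show "linear ?f" by (simp add: coord_simps algebra_simps)
  show "x = 0" if "?f x = 0" for x
  proof -
    have e: "r' * (2 * x$1 + x$2) = 0" "(2 * r - q) * x$1 + (r - q) * x$2 = 0" "x$3 = 0"
      "b * x$3 - r' * q * x$4 = 0"
      using that assms by (auto simp: coord_simps algebra_simps)
    have "- 2 * r' * a * x$5 - r' * a * x$6 = 0" "(2 * r - q) * a * x$5 + r * a * x$6 = 0"
      using that e(4) by (simp_all add: coord_simps)
    then have "r' * a * (2 * x$5 + x$6) = 0" "a * ((2 * r - q) * x$5 + r * x$6) = 0" by algebra+
    then have f: "2 * x$5 + x$6 = 0" "(2 * r - q) * x$5 + r * x$6 = 0" using a0 assms by auto
    have g: "2 * x$1 + x$2 = 0" using e(1) assms by auto
    have "q * x$1 = 0" using g e(2) by algebra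
    moreover have "q * x$5 = 0" using f by algebra
    ultimately show ?thesis using assms e(3,4) f(1) g by (auto simp: coord_simps)
  qed
  show "?f (h13 x y) = born_model r q w r' 0 w' (?f x) (?f y)" for x y
    by (simp add: coord_simps a_def b_def) (simp add: algebra_simps power2_eq_square)
qed

text \<open>Rotate so that \<open>q' = 0\<close>; if \<open>q\<close> and \<open>q'\<close> both vanish, the rotation is free to achieve \<open>r' = 0\<close>.\<close>

lemma model_classification:
  assumes "\<not> abelian_lie (born_model r q w r' q' w')"
  defines "m \<equiv> born_model r q w r' q' w'"
  shows "lie_isomorphic m h4 \<or> lie_isomorphic m h7 \<or> lie_isomorphic m h8 \<or>
    lie_isomorphic m h9 \<or> lie_isomorphic m h10 \<or> lie_isomorphic m h11 \<or> lie_isomorphic m h13"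
proof -
  have "\<exists>r1 q1 w1 r1' w1'. lie_isomorphic m (born_model r1 q1 w1 r1' 0 w1') \<and> (q1 = 0 \<longrightarrow> r1' = 0)"
  proof (cases "q = 0 \<and> q' = 0")
    case False
    from model_rotate[of q q' r q w r' q' w'] False
    have "lie_isomorphic m (born_model (q * r + q' * r') (q * q + q' * q') (q * w + q' * w')
       (q * r' - q' * r) 0 (q * w' - q' * w))" by (simp add: m_def mult.commute)
    moreover have "q * q + q' * q' \<noteq> 0" using False by (simp add: sum_squares_eq_zero_iff)
    ultimately show ?thesis by blast
  next
    case q: True
    show ?thesis
    proof (cases "r = 0 \<and> r' = 0")
      case True
      have "lie_isomorphic m m" using model_rotate[of 1 0 r q w r' q' w'] by (simp add: m_def)
      then have "lie_isomorphic m (born_model 0 0 w 0 0 w')" using q True by (simp add: m_def)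
      then show ?thesis by blast
    next
      case False
      from model_rotate[of r r' r q w r' q' w'] False q
      have "lie_isomorphic m (born_model (r * r + r' * r') 0 (r * w + r' * w')
         0 0 (r * w' - r' * w))" by (simp add: m_def mult.commute)
      then show ?thesis by blast
    qed
  qed
  then obtain r1 q1 w1 r1' w1' where iso: "lie_isomorphic m (born_model r1 q1 w1 r1' 0 w1')"
    and q0: "q1 = 0 \<Longrightarrow> r1' = 0" by blast
  have na: "\<not> abelian_lie (born_model r1 q1 w1 r1' 0 w1')"
    using abelian_lie_isomorphic[OF iso] assms(1) by (auto simp: m_def)
  have ab: "abelian_lie (born_model 0 0 0 0 0 0)" by (simp add: abelian_lie_def coord_simps)
  note T = lie_isomorphic_trans[OF iso]
  show ?thesis
  proof (cases "q1 = 0")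
    case q: True
    show ?thesis
    proof (cases "r1 = 0")
      case True
      then have "w1 \<noteq> 0 \<or> w1' \<noteq> 0" using na ab q q0 by auto
      then show ?thesis using T[of h8] model_h8 True q q0 by auto
    next
      case False
      then show ?thesis using T[of h4] model_h4 q q0 by auto
    qed
  next
    case q: False
    consider "r1' \<noteq> 0" | "r1' = 0" "r1 = 0" | "r1' = 0" "r1 = q1" | "r1' = 0" "q1 = 2 * r1"
      | "r1' = 0" "r1 \<noteq> 0" "r1 \<noteq> q1" "2 * r1 \<noteq> q1" by argo
    then show ?thesis
    proof cases
      case 1 then show ?thesis using T[of h13] model_h13 q by auto
    next
      case 2 then show ?thesis using T[of h10] model_h10 q by auto
    next
      case 3 then show ?thesis using T[of h9] model_h9 q by auto
    next
      case 4 then show ?thesis using T[of h7] model_h7 q by auto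
    next
      case 5 then show ?thesis using T[of h11] model_h11 q by auto
    qed
  qed
qed

text \<open>The metric pairs \<open>X\<close> with \<open>E\<close> and \<open>Y\<close> with \<open>Z\<close> and makes \<open>U, P\<close> orthonormal; the splitting is
  \<open>\<langle>X, U, E\<rangle> \<oplus> \<langle>Y, P, Z\<rangle>\<close>.\<close>

lemma born_model_integrable:
  "\<exists>h J Vp Vm. integrable_born_structure (born_model r q w r' q' w') h J Vp Vm"
proof -
  define h :: "real^6 \<Rightarrow> real^6 \<Rightarrow> real" where
    "h x y = x$1 * y$5 + x$5 * y$1 + x$3 * y$3 + x$2 * y$6 + x$6 * y$2 + x$4 * y$4" for x y
  define J :: "real^6 \<Rightarrow> real^6" where "J x = vec6 (- x$2) (x$1) (- x$4) (x$3) (- x$6) (x$5)" for x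
  define Vp :: "(real^6) set" where "Vp = {x. x$2 = 0 \<and> x$4 = 0 \<and> x$6 = 0}"
  define Vm :: "(real^6) set" where "Vm = {x. x$1 = 0 \<and> x$3 = 0 \<and> x$5 = 0}"
  note d = h_def J_def Vp_def Vm_def
  have "nondegenerate h" unfolding nondegenerate_def
  proof (intro allI impI)
    fix x assume "\<forall>y. h x y = 0"
    then have "h x (axis i 1) = 0" for i by blast
    from this[of 1] this[of 2] this[of 3] this[of 4] this[of 5] this[of 6]
    show "x = 0" by (simp add: h_def axis_def coord_simps)
  qed
  then have 1: "pseudo_metric h"
    by (simp add: pseudo_metric_def bilinear_def linear_iff h_def algebra_simps)
  have 2: "linear J" by (simp add: J_def coord_simps)
  have 3: "J (J x) = - x" "h (J x) (J y) = h x y" for x y by (simp_all add: d coord_simps)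
  have 4: "subspace Vp" "subspace Vm" by (simp_all add: d subspace_def)
  have 5: "Vp \<inter> Vm = {0}" by (auto simp: d coord_simps)
  have 6: "\<exists>u\<in>Vp. \<exists>v\<in>Vm. x = u + v" for x
    by (rule bexI[of _ "vec6 (x$1) 0 (x$3) 0 (x$5) 0"], rule bexI[of _ "vec6 0 (x$2) 0 (x$4) 0 (x$6)"])
      (simp_all add: d coord_simps)
  have 7: "h u v = 0" if "u \<in> Vp" "v \<in> Vm" for u v using that by (simp add: d)
  have m: "J x \<in> Vm" if "x \<in> Vp" for x using that by (simp add: d)
  have m': "J x \<in> Vp" if "x \<in> Vm" for x using that by (simp add: d)
  have e: "x = J (- J x)" for x by (simp add: d coord_simps)
  have 8: "J ` Vp = Vm" "J ` Vm = Vp"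
    using m m' e subspace_neg[OF 4(1)] subspace_neg[OF 4(2)] by (blast intro: image_eqI)+
  have 9: "ce_d2 (born_model r q w r' q' w') (\<lambda>a b. h (J a) b) x y z = 0" for x y z
    by (simp add: d ce_d2_def born_model_def Let_def) (simp add: algebra_simps)
  have 10: "nijenhuis (born_model r q w r' q' w') J x y = 0" for x y
    by (simp add: d nijenhuis_def coord_simps) (simp add: algebra_simps)
  have 11: "lie_subalgebra (born_model r q w r' q' w') Vp" "lie_subalgebra (born_model r q w r' q' w') Vm"
    using 4 by (auto simp: lie_subalgebra_def d coord_simps)
  have "integrable_born_structure (born_model r q w r' q' w') h J Vp Vm"
    unfolding integrable_born_structure_encoding
    by (intro conjI allI ballI) (rule 1 2 3 4 5 6 7 8 9 10 11; assumption?)+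
  then show ?thesis by blast
qed

lemma listed_algebra_is_model:
  assumes "br \<in> {h4, h7, h8, h9, h10, h11, h13}"
  shows "\<exists>r q w r' q' w'. lie_isomorphic (born_model r q w r' q' w') br"
proof -
  consider "br = h4" | "br = h7" | "br = h8" | "br = h9" | "br = h10" | "br = h11" | "br = h13"
    using assms by blast
  then show ?thesis
  proof cases
    case 1 then show ?thesis using model_h4[of 1 0 0] by fastforce
  next
    case 2 then show ?thesis using model_h7[of 1 0 0] by fastforce
  next
    case 3 then show ?thesis using model_h8[of 1 0] by fastforce
  next
    case 4 then show ?thesis using model_h9[of 1 0 0] by fastforce
  next
    case 5 then show ?thesis using model_h10[of 1 0 0] by fastforce
  next
    case 6 then show ?thesis using model_h11[of 1 3 0 0] by fastforce
  next
    case 7 then show ?thesis using model_h13[of 1 1 0 0 0] by fastforce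
  qed
qed

section \<open>Nilpotent Hessian structures in dimension three\<close>

lemma mem_span1: "(x::'a::real_vector) \<in> span {a} \<longleftrightarrow> (\<exists>k. x = k *\<^sub>R a)"
  by (auto simp: span_singleton)

lemma mem_span2: "(x::'a::real_vector) \<in> span {a, b} \<longleftrightarrow> (\<exists>k l. x = k *\<^sub>R a + l *\<^sub>R b)"
  by (auto simp: span_breakdown_eq algebra_simps)

lemma mem_span3: "(x::'a::real_vector) \<in> span {a, b, c} \<longleftrightarrow> (\<exists>k l m. x = k *\<^sub>R a + l *\<^sub>R b + m *\<^sub>R c)"
  by (auto simp: span_breakdown_eq algebra_simps)

text \<open>\<open>D\<close> is a flat left-invariant connection, torsion free for the bracket \<open>D x y - D y x\<close>, and \<open>codazzi\<close>
  says that the metric is Hessian for it. The last assumption expresses that the operators \<open>D x\<close> are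
  simultaneously strictly triangular: the first member of a triangular flag that is not contained
  in \<open>S\<close> supplies \<open>v\<close>.\<close>

locale nilpotent_hessian =
  fixes V :: "'a::real_vector set" and h :: "'a \<Rightarrow> 'a \<Rightarrow> real" and D :: "'a \<Rightarrow> 'a \<Rightarrow> 'a"
  assumes V: "subspace V" "dim V = 3"
    and h: "bilinear h" "h x y = h y x"
    and nondeg: "\<lbrakk>x \<in> V; \<And>y. y \<in> V \<Longrightarrow> h x y = 0\<rbrakk> \<Longrightarrow> x = 0"
    and D: "bilinear D" "\<lbrakk>x \<in> V; y \<in> V\<rbrakk> \<Longrightarrow> D x y \<in> V"
    and flat: "\<lbrakk>x \<in> V; y \<in> V; z \<in> V\<rbrakk> \<Longrightarrow> D (D x y - D y x) z = D x (D y z) - D y (D x z)"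
    and codazzi: "\<lbrakk>x \<in> V; y \<in> V; z \<in> V\<rbrakk> \<Longrightarrow> h (D x y) z + h y (D x z) = h (D y x) z + h x (D y z)"
    and nilpotent: "\<lbrakk>subspace S; S \<subseteq> V; S \<noteq> V\<rbrakk> \<Longrightarrow> \<exists>v\<in>V - S. \<forall>x\<in>V. D x v \<in> S"
begin

lemmas h_simps = bilinear_ladd[OF h(1)] bilinear_radd[OF h(1)] bilinear_lsub[OF h(1)]
  bilinear_rsub[OF h(1)] bilinear_lmul[OF h(1)] bilinear_rmul[OF h(1)] bilinear_lneg[OF h(1)]
  bilinear_rneg[OF h(1)] bilinear_lzero[OF h(1)] bilinear_rzero[OF h(1)]

lemmas D_simps = bilinear_ladd[OF D(1)] bilinear_radd[OF D(1)] bilinear_lsub[OF D(1)]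
  bilinear_rsub[OF D(1)] bilinear_lmul[OF D(1)] bilinear_rmul[OF D(1)] bilinear_lneg[OF D(1)]
  bilinear_rneg[OF D(1)] bilinear_lzero[OF D(1)] bilinear_rzero[OF D(1)]

lemmas V_intros = subspace_add[OF V(1)] subspace_diff[OF V(1)] subspace_scale[OF V(1)]
  subspace_neg[OF V(1)] subspace_0[OF V(1)] D(2)

lemma basis_triple:
  assumes "b1 \<in> V" "b2 \<in> V" "b3 \<in> V" "b1 \<noteq> 0" "b2 \<notin> span {b1}" "b3 \<notin> span {b1, b2}"
  shows "V = span {b1, b2, b3}"
proof
  have ind: "independent {b3, b2, b1}"
    using assms by (intro independent_insertI) (auto simp: insert_commute independent_empty)
  obtain B where B: "B \<subseteq> V" "independent B" "V \<subseteq> span B" "card B = dim V"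
    using basis_exists by blast
  have fB: "finite B" using B(4) V(2) by (metis card.infinite zero_neq_numeral)
  show "V \<subseteq> span {b1, b2, b3}"
  proof (rule ccontr)
    assume "\<not> V \<subseteq> span {b1, b2, b3}"
    then obtain v where v: "v \<in> V" "v \<notin> span {b3, b2, b1}" by (auto simp: insert_commute)
    have "independent {v, b3, b2, b1}" using v(2) ind by (rule independent_insertI)
    moreover have "{v, b3, b2, b1} \<subseteq> span B" using assms v B by auto
    ultimately have "card {v, b3, b2, b1} \<le> 3"
      using independent_span_bound[OF fB] B(4) V(2) by metis
    moreover have "v \<notin> {b3, b2, b1}" using v(2) span_base[of v "{b3, b2, b1}"] by auto
    moreover have "b3 \<noteq> b2" "b3 \<noteq> b1" "b2 \<noteq> b1" using assms(5,6) by (auto simp: span_base)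
    ultimately show False by simp
  qed
  show "span {b1, b2, b3} \<subseteq> V" using assms V(1) by (intro span_minimal) auto
qed

text \<open>Relative to this basis all operators \<open>D x\<close> are strictly upper triangular.\<close>

definition flag :: "'a \<Rightarrow> 'a \<Rightarrow> 'a \<Rightarrow> bool" where
  "flag b1 b2 b3 \<longleftrightarrow> b1 \<in> V \<and> b2 \<in> V \<and> b3 \<in> V \<and> b1 \<noteq> 0 \<and> b2 \<notin> span {b1} \<and> b3 \<notin> span {b1, b2} \<and>
     (\<forall>x\<in>V. D x b1 = 0 \<and> D x b2 \<in> span {b1} \<and> D x b3 \<in> span {b1, b2})"

text \<open>Apply \<open>nilpotent\<close> three times, to the span of the vectors already found.\<close>

lemma flag_exists: "\<exists>b1 b2 b3. flag b1 b2 b3"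
proof -
  have ne: "span S \<noteq> V" if "card S \<le> 2" "finite S" for S
  proof
    assume "span S = V"
    then have "dim V \<le> card S" using dim_le_card[of V S] that by auto
    then show False using V(2) that by simp
  qed
  have sub: "span S \<subseteq> V" if "S \<subseteq> V" for S using that V(1) by (rule span_minimal)
  obtain b1 where b1: "b1 \<in> V" "b1 \<noteq> 0" "\<And>x. x \<in> V \<Longrightarrow> D x b1 = 0"
    using nilpotent[of "{0}"] ne[of "{}"] subspace_0[OF V(1)] by auto
  have c: "card {b1, b2} \<le> 2" for b2 by (simp add: card_insert_if)
  obtain b2 where b2: "b2 \<in> V" "b2 \<notin> span {b1}" "\<And>x. x \<in> V \<Longrightarrow> D x b2 \<in> span {b1}"
    using nilpotent[OF subspace_span sub ne, of "{b1}"] b1 by auto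
  obtain b3 where b3: "b3 \<in> V" "b3 \<notin> span {b1, b2}" "\<And>x. x \<in> V \<Longrightarrow> D x b3 \<in> span {b1, b2}"
    using nilpotent[OF subspace_span sub ne, of "{b1, b2}"] b1 b2 c by auto
  show ?thesis using b1 b2 b3 unfolding flag_def by blast
qed

lemma flag_shift2:
  assumes "flag b1 b2 b3" shows "flag b1 (b2 - k *\<^sub>R b1) b3"
proof -
  let ?c = "b2 - k *\<^sub>R b1"
  have f: "b1 \<in> V" "b2 \<in> V" "b3 \<in> V" "b1 \<noteq> 0" "b2 \<notin> span {b1}" "b3 \<notin> span {b1, b2}"
    "\<And>x. x \<in> V \<Longrightarrow> D x b1 = 0 \<and> D x b2 \<in> span {b1} \<and> D x b3 \<in> span {b1, b2}"
    using assms unfolding flag_def by auto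
  have s: "span {b1, ?c} = span {b1, b2}"
  proof (rule span_eq[THEN iffD2], intro conjI subsetI)
    have "?c = (- k) *\<^sub>R b1 + 1 *\<^sub>R b2" "b2 = k *\<^sub>R b1 + 1 *\<^sub>R ?c" by simp_all
    then show "x \<in> span {b1, b2}" if "x \<in> {b1, ?c}" for x
      using that span_base[of b1 "{b1, b2}"] unfolding mem_span2 by blast
    from \<open>b2 = k *\<^sub>R b1 + 1 *\<^sub>R ?c\<close> show "x \<in> span {b1, ?c}" if "x \<in> {b1, b2}" for x
      using that span_base[of b1 "{b1, ?c}"] unfolding mem_span2 by blast
  qed
  have "?c \<notin> span {b1}"
    using f(5) span_add[of ?c "{b1}" "k *\<^sub>R b1"] by (auto simp: span_base span_scale)
  then show ?thesis
    unfolding flag_def s using f by (auto simp: V_intros D_simps)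
qed

lemma flag_shift3:
  assumes "flag b1 b2 b3" shows "flag b1 b2 (b3 - k *\<^sub>R b1 - l *\<^sub>R b2)"
proof -
  let ?c = "b3 - k *\<^sub>R b1 - l *\<^sub>R b2"
  have f: "b1 \<in> V" "b2 \<in> V" "b3 \<in> V" "b1 \<noteq> 0" "b2 \<notin> span {b1}" "b3 \<notin> span {b1, b2}"
    "\<And>x. x \<in> V \<Longrightarrow> D x b1 = 0 \<and> D x b2 \<in> span {b1} \<and> D x b3 \<in> span {b1, b2}"
    using assms unfolding flag_def by auto
  have d: "k *\<^sub>R b1 + l *\<^sub>R b2 \<in> span {b1, b2}" unfolding mem_span2 by blast
  have "?c \<notin> span {b1, b2}"
    using f(6) span_add[OF _ d, of ?c] by auto
  moreover have "D x ?c \<in> span {b1, b2}" if "x \<in> V" for x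
  proof -
    have "D x b2 \<in> span {b1, b2}" using f(7)[OF that] span_mono[of "{b1}" "{b1, b2}"] by auto
    then show ?thesis using f(7)[OF that] by (simp add: D_simps span_diff span_scale)
  qed
  ultimately show ?thesis
    unfolding flag_def using f by (auto simp: V_intros)
qed

lemma flag_spans: "flag b1 b2 b3 \<Longrightarrow> V = span {b1, b2, b3}"
  unfolding flag_def by (intro basis_triple) auto

lemma flag_nondeg:
  assumes f: "flag b1 b2 b3" and x: "x \<in> {b1, b2, b3}" and "h x b1 = 0" "h x b2 = 0" "h x b3 = 0"
  shows False
proof -
  have "x \<in> V" using x f by (auto simp: flag_def)
  moreover have "h x y = 0" if "y \<in> V" for y
    using that assms(3-5) unfolding flag_spans[OF f] mem_span3 by (auto simp: h_simps)
  ultimately have "x = 0" by (rule nondeg)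
  then show False using x f span_0 unfolding flag_def by auto
qed

lemma flag_constants:
  assumes "flag b1 b2 b3"
  obtains a1 a2 a3 c1 c2 c3 d1 d2 d3 where
    "D b1 b1 = 0" "D b2 b1 = 0" "D b3 b1 = 0"
    "D b1 b2 = a1 *\<^sub>R b1" "D b2 b2 = a2 *\<^sub>R b1" "D b3 b2 = a3 *\<^sub>R b1"
    "D b1 b3 = c1 *\<^sub>R b1 + d1 *\<^sub>R b2" "D b2 b3 = c2 *\<^sub>R b1 + d2 *\<^sub>R b2" "D b3 b3 = c3 *\<^sub>R b1 + d3 *\<^sub>R b2"
proof -
  have "\<exists>a c d. D x b1 = 0 \<and> D x b2 = a *\<^sub>R b1 \<and> D x b3 = c *\<^sub>R b1 + d *\<^sub>R b2" if "x \<in> V" for x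
    using assms that unfolding flag_def mem_span1 mem_span2 by blast
  then show ?thesis using that assms unfolding flag_def by metis
qed

text \<open>The flag \<open>\<langle>e\<rangle> \<subseteq> e\<^sup>\<bottom> \<subseteq> V\<close> is strictly triangular for all \<open>D x\<close>. The condition depends only on the null
  line of \<open>e\<close>, which makes it possible to compare the flags of two different products.\<close>

definition adapted :: "'a \<Rightarrow> bool" where
  "adapted e \<longleftrightarrow> e \<in> V \<and> e \<noteq> 0 \<and> h e e = 0 \<and>
     (\<forall>x\<in>V. D x e = 0 \<and> (\<forall>y\<in>V. h (D x y) e = 0 \<and> (h y e = 0 \<longrightarrow> D x y \<in> span {e})))"

lemma adaptedI:
  assumes f: "flag b1 b2 b3" and "h b1 b1 = 0" "h b1 b2 = 0"
  shows "adapted b1"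
  unfolding adapted_def
proof (intro conjI ballI impI)
  have m: "b1 \<in> V" "b1 \<noteq> 0" "\<And>x. x \<in> V \<Longrightarrow> D x b1 = 0 \<and> D x b2 \<in> span {b1} \<and> D x b3 \<in> span {b1, b2}"
    using f unfolding flag_def by auto
  show "b1 \<in> V" "b1 \<noteq> 0" "h b1 b1 = 0" using m assms by auto
  fix x assume x: "x \<in> V"
  show "D x b1 = 0" using m x by simp
  fix y assume "y \<in> V"
  then obtain k l n where y: "y = k *\<^sub>R b1 + l *\<^sub>R b2 + n *\<^sub>R b3"
    unfolding flag_spans[OF f] mem_span3 by blast
  obtain a c d where Dx: "D x b1 = 0" "D x b2 = a *\<^sub>R b1" "D x b3 = c *\<^sub>R b1 + d *\<^sub>R b2"
    using m(3)[OF x] unfolding mem_span1 mem_span2 by blast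
  show "h (D x y) b1 = 0"
    using assms(2,3) h(2)[of b2 b1] by (simp add: y D_simps Dx h_simps)
  assume "h y b1 = 0"
  moreover have "h b3 b1 \<noteq> 0"
    using flag_nondeg[OF f, of b1] assms h(2)[of b3 b1] by auto
  ultimately have "n = 0" using assms(2,3) h(2)[of b2 b1] by (simp add: y h_simps)
  then show "D x y \<in> span {b1}" by (simp add: y D_simps Dx span_base span_scale)
qed

text \<open>Symmetry of \<open>h (D x y) z + h y (D x z)\<close> leaves a single constant, the common value of
  \<open>h (D b1 b3) b2\<close>, \<open>h (D b2 b3) b1\<close> and \<open>h (D b3 b2) b1\<close>. Flatness on \<open>b1, b3, b3\<close> equates its square
  with minus its square.\<close>

lemma flag_orthogonal_trivial:
  assumes f: "flag b1 b2 b3" and o: "h b1 b2 = 0" "h b1 b3 = 0" "h b2 b3 = 0"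
    and x: "x \<in> V" and y: "y \<in> V"
  shows "D x y = 0"
proof -
  have o': "h b2 b1 = 0" "h b3 b1 = 0" "h b3 b2 = 0" using o h(2) by metis+
  have g: "h b1 b1 \<noteq> 0" "h b2 b2 \<noteq> 0" "h b3 b3 \<noteq> 0"
    using flag_nondeg[OF f] o o' by blast+
  have m: "b1 \<in> V" "b2 \<in> V" "b3 \<in> V" "b1 \<noteq> 0" using f unfolding flag_def by auto
  obtain a1 a2 a3 c1 c2 c3 d1 d2 d3 where c:
    "D b1 b1 = 0" "D b2 b1 = 0" "D b3 b1 = 0"
    "D b1 b2 = a1 *\<^sub>R b1" "D b2 b2 = a2 *\<^sub>R b1" "D b3 b2 = a3 *\<^sub>R b1"
    "D b1 b3 = c1 *\<^sub>R b1 + d1 *\<^sub>R b2" "D b2 b3 = c2 *\<^sub>R b1 + d2 *\<^sub>R b2" "D b3 b3 = c3 *\<^sub>R b1 + d3 *\<^sub>R b2"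
    by (rule flag_constants[OF f])
  note C = codazzi[OF m(1) m(2) m(1)] codazzi[OF m(1) m(2) m(2)] codazzi[OF m(1) m(2) m(3)]
     codazzi[OF m(1) m(3) m(1)] codazzi[OF m(1) m(3) m(2)] codazzi[OF m(1) m(3) m(3)]
     codazzi[OF m(2) m(3) m(1)] codazzi[OF m(2) m(3) m(2)] codazzi[OF m(2) m(3) m(3)]
  note C' = C[unfolded c, simplified h_simps o o', simplified]
  have z: "a1 = 0" "a2 = 0" "c1 = 0" "c3 = 0" "d2 = 0" "d3 = 0"
    using C' g by auto
  have e: "d1 * h b2 b2 = a3 * h b1 b1" "c2 * h b1 b1 = a3 * h b1 b1"
    using C' z by auto
  have "D (D b1 b3 - D b3 b1) b3 = D b1 (D b3 b3) - D b3 (D b1 b3)" by (rule flat[OF m(1,3,3)])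
  then have "(d1 * c2 + d1 * a3) *\<^sub>R b1 = 0" by (simp add: c z D_simps algebra_simps)
  then have "d1 * (c2 + a3) = 0" using m(4) by (metis distrib_left scaleR_eq_0_iff)
  moreover have "c2 = a3" using e(2) g by simp
  ultimately have "d1 * a3 = 0" by auto
  then have "d1 = 0 \<and> a3 = 0 \<and> c2 = 0" using e g by auto
  then have "D b b' = 0" if "b \<in> {b1, b2, b3}" "b' \<in> {b1, b2, b3}" for b b'
    using that c z by auto
  then show ?thesis
    using x y unfolding flag_spans[OF f] mem_span3 by (auto simp: D_simps)
qed

text \<open>By an indefinite Gram--Schmidt process a flag can be adjusted to one of four types. If it is
  orthogonal, \<open>D\<close> vanishes. If \<open>b1\<close> is null and orthogonal to \<open>b2\<close>, it is adapted. If \<open>b1\<close> is null and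
  paired with \<open>b2\<close>, or if \<open>b1\<close> is not null and \<open>b2\<close> is a null vector orthogonal to it, symmetry kills
  further constants, so that \<open>b2, b3\<close> or \<open>b1, b2\<close> can be interchanged; this leads back to the
  second type.\<close>

lemma adapted_exists:
  assumes "\<not> (\<forall>x\<in>V. \<forall>y\<in>V. D x y = 0)"
  shows "\<exists>e. adapted e"
proof -
  obtain b1 b2 b3 where f: "flag b1 b2 b3" using flag_exists by blast
  show ?thesis
  proof (cases "h b1 b1 = 0")
    case b11: True
    show ?thesis
    proof (cases "h b1 b2 = 0")
      case True
      then show ?thesis using adaptedI[OF f b11] by blast
    next
      case p: False
      \<comment> \<open>\<open>b1\<close> is paired with \<open>b2\<close>: make the third vector orthogonal to both and move it to the middle.\<close>
      define l where "l = h b3 b1 / h b1 b2"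
      define k where "k = (h b3 b2 - l * h b2 b2) / h b1 b2"
      define u where "u = b3 - k *\<^sub>R b1 - l *\<^sub>R b2"
      have g: "flag b1 b2 u" unfolding u_def by (rule flag_shift3[OF f])
      have o: "h u b1 = 0" "h u b2 = 0" using p h(2)[of b2 b1] b11
        by (simp_all add: u_def h_simps l_def k_def field_simps)
      have o': "h b1 u = 0" "h b2 u = 0" using o h(2) by metis+
      have q: "h b2 b1 \<noteq> 0" using p h(2)[of b2 b1] by simp
      have m: "b1 \<in> V" "b2 \<in> V" "u \<in> V" "b1 \<noteq> 0" using g unfolding flag_def by auto
      obtain a1 a2 a3 c1 c2 c3 d1 d2 d3 where c:
        "D b1 b1 = 0" "D b2 b1 = 0" "D u b1 = 0"
        "D b1 b2 = a1 *\<^sub>R b1" "D b2 b2 = a2 *\<^sub>R b1" "D u b2 = a3 *\<^sub>R b1"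
        "D b1 u = c1 *\<^sub>R b1 + d1 *\<^sub>R b2" "D b2 u = c2 *\<^sub>R b1 + d2 *\<^sub>R b2" "D u u = c3 *\<^sub>R b1 + d3 *\<^sub>R b2"
        by (rule flag_constants[OF g])
      note C = codazzi[OF m(1) m(3) m(1)] codazzi[OF m(1) m(3) m(3)] codazzi[OF m(2) m(3) m(1)]
      have d: "d1 = 0" "d2 = 0" "d3 = 0"
        using C[unfolded c] p q by (auto simp: h_simps o o' b11)
      have D1: "D x u \<in> span {b1} \<and> D x b2 \<in> span {b1} \<and> D x b1 = 0" if "x \<in> V" for x
      proof -
        have "D x b2 \<in> span {b1} \<and> D x b1 = 0" using g that unfolding flag_def by blast
        moreover obtain k l n where "x = k *\<^sub>R b1 + l *\<^sub>R b2 + n *\<^sub>R u"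
          using \<open>x \<in> V\<close> unfolding flag_spans[OF g] mem_span3 by blast
        then have "D x u \<in> span {b1}"
          by (simp add: D_simps c d span_add span_scale span_base)
        ultimately show ?thesis by blast
      qed
      have s: "u \<notin> span {b1}" using g span_mono[of "{b1}" "{b1, b2}"] unfolding flag_def by auto
      have "b2 \<notin> span {b1, u}"
      proof
        assume "b2 \<in> span {b1, u}"
        then have "h b2 b1 = 0" unfolding mem_span2 by (auto simp: h_simps b11 o)
        then show False using q by simp
      qed
      then have "flag b1 u b2"
        unfolding flag_def using m s D1 span_mono[of "{b1}" "{b1, u}"] by auto
      then show ?thesis using adaptedI b11 o'(1) by blast
    qed
  next
    case b11: False
    define u where "u = b2 - (h b2 b1 / h b1 b1) *\<^sub>R b1"
    define v where "v = b3 - (h b3 b1 / h b1 b1) *\<^sub>R b1 - 0 *\<^sub>R u"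
    have g: "flag b1 u v" unfolding v_def u_def by (intro flag_shift3 flag_shift2 f)
    have "h u b1 = 0" "h v b1 = 0" using b11 by (simp_all add: u_def v_def h_simps)
    then have o: "h u b1 = 0" "h v b1 = 0" "h b1 u = 0" "h b1 v = 0" using h(2) by metis+
    show ?thesis
    proof (cases "h u u = 0")
      case False
      define v' where "v' = v - 0 *\<^sub>R b1 - (h v u / h u u) *\<^sub>R u"
      have g': "flag b1 u v'" unfolding v'_def by (rule flag_shift3[OF g])
      have "h v' u = 0" using False by (simp add: v'_def h_simps o)
      then have "h u v' = 0" using h(2) by metis
      moreover have "h b1 v' = 0" by (simp add: v'_def h_simps o)
      ultimately show ?thesis using flag_orthogonal_trivial[OF g' o(3)] assms by blast
    next
      case uu: True
      \<comment> \<open>\<open>u\<close> is null and paired with \<open>v\<close>: symmetry makes all \<open>D x u\<close> vanish, so that \<open>u\<close> can come first.\<close>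
      have uv: "h u v \<noteq> 0" using flag_nondeg[OF g, of u] o uu by auto
      have vu: "h v u \<noteq> 0" using uv h(2) by metis
      have m: "b1 \<in> V" "u \<in> V" "v \<in> V" "b1 \<noteq> 0" using g unfolding flag_def by auto
      obtain a1 a2 a3 c1 c2 c3 d1 d2 d3 where c:
        "D b1 b1 = 0" "D u b1 = 0" "D v b1 = 0"
        "D b1 u = a1 *\<^sub>R b1" "D u u = a2 *\<^sub>R b1" "D v u = a3 *\<^sub>R b1"
        "D b1 v = c1 *\<^sub>R b1 + d1 *\<^sub>R u" "D u v = c2 *\<^sub>R b1 + d2 *\<^sub>R u" "D v v = c3 *\<^sub>R b1 + d3 *\<^sub>R u"
        by (rule flag_constants[OF g])
      note C = codazzi[OF m(1) m(2) m(1)] codazzi[OF m(1) m(2) m(2)] codazzi[OF m(1) m(3) m(2)]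
      have d: "a1 = 0" "a2 = 0" "a3 = 0"
        using C[unfolded c] b11 by (auto simp: h_simps o uu)
      have D1: "D x u = 0 \<and> D x b1 = 0 \<and> D x v \<in> span {b1, u}" if "x \<in> V" for x
      proof -
        have "D x v \<in> span {b1, u} \<and> D x b1 = 0" using g that unfolding flag_def by blast
        moreover obtain k l n where "x = k *\<^sub>R b1 + l *\<^sub>R u + n *\<^sub>R v"
          using \<open>x \<in> V\<close> unfolding flag_spans[OF g] mem_span3 by blast
        then have "D x u = 0" by (simp add: D_simps c d)
        ultimately show ?thesis by blast
      qed
      have "b1 \<notin> span {u}"
      proof
        assume "b1 \<in> span {u}"
        then have "h b1 b1 = 0" unfolding mem_span1 by (auto simp: h_simps uu)
        then show False using b11 by simp
      qed
      moreover have "u \<noteq> 0" using uv by (auto simp: h_simps)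
      moreover have "v \<notin> span {u, b1}" using g unfolding flag_def by (simp add: insert_commute)
      ultimately have "flag u b1 v"
        unfolding flag_def using m D1 by (auto simp: insert_commute span_0)
      then show ?thesis using adaptedI uu o(1) by blast
    qed
  qed
qed

text \<open>With the common value \<open>\<epsilon>\<close> for \<open>h u u\<close> and \<open>h e f\<close>, the structure constants below are independent of
  \<open>\<epsilon>\<close>, so that both signs of the metric are covered at once.\<close>

definition null_frame :: "'a \<Rightarrow> 'a \<Rightarrow> 'a \<Rightarrow> real \<Rightarrow> bool" where
  "null_frame e u f \<epsilon> \<longleftrightarrow> e \<in> V \<and> u \<in> V \<and> f \<in> V \<and> \<epsilon> \<noteq> 0 \<and> h e e = 0 \<and> h f f = 0 \<and> h e u = 0 \<and> h u e = 0 \<and>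
     h u f = 0 \<and> h f u = 0 \<and> h u u = \<epsilon> \<and> h e f = \<epsilon> \<and> h f e = \<epsilon>"

lemma null_frame_spans:
  assumes "null_frame e u f \<epsilon>" shows "V = span {e, u, f}"
proof (rule basis_triple)
  note a = assms[unfolded null_frame_def]
  show "e \<in> V" "u \<in> V" "f \<in> V" using a by auto
  show "e \<noteq> 0" using a by (auto simp: h_simps)
  show "u \<notin> span {e}" unfolding mem_span1
  proof
    assume "\<exists>k. u = k *\<^sub>R e"
    then have "h u u = 0" using a by (auto simp: h_simps)
    then show False using a by auto
  qed
  show "f \<notin> span {e, u}" unfolding mem_span2
  proof
    assume "\<exists>k l. f = k *\<^sub>R e + l *\<^sub>R u"
    then have "h f e = 0" using a by (auto simp: h_simps)
    then show False using a by auto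
  qed
qed

lemma null_frame_exists_pair:
  assumes e: "e \<in> V" "h e e = 0" and f: "f \<in> V" "h f f = 0" and ef: "h e f \<noteq> 0"
  shows "\<exists>u k \<epsilon>. k \<noteq> 0 \<and> null_frame e u (k *\<^sub>R f) \<epsilon>"
proof -
  have fe: "h f e = h e f" by (rule h(2))
  have "dim (span {e, f}) \<le> 2"
    using dim_le_card[of "span {e, f}" "{e, f}"] by (auto simp: card_insert_if split: if_splits)
  then have "span {e, f} \<noteq> V" using V(2) by auto
  moreover have "span {e, f} \<subseteq> V" using e f V(1) by (intro span_minimal) auto
  ultimately obtain v where v: "v \<in> V" "v \<notin> span {e, f}" by blast
  define u where "u = v - (h v f / h e f) *\<^sub>R e - (h v e / h e f) *\<^sub>R f"
  have uV: "u \<in> V" using v e f by (simp add: u_def V_intros)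
  have o: "h u e = 0" "h u f = 0" using ef fe e f by (simp_all add: u_def h_simps)
  have o': "h e u = 0" "h f u = 0" using o h(2) by metis+
  have uns: "u \<notin> span {e, f}"
  proof
    assume "u \<in> span {e, f}"
    moreover have "(h v f / h e f) *\<^sub>R e + (h v e / h e f) *\<^sub>R f \<in> span {e, f}" unfolding mem_span2 by blast
    ultimately have "u + ((h v f / h e f) *\<^sub>R e + (h v e / h e f) *\<^sub>R f) \<in> span {e, f}" by (rule span_add)
    then show False using v by (simp add: u_def)
  qed
  have e0: "e \<noteq> 0" using ef by (auto simp: h_simps)
  have f0: "f \<notin> span {e}"
    unfolding mem_span1 using ef e by (auto simp: h_simps)
  have S: "V = span {e, f, u}" by (rule basis_triple) (use e f uV e0 f0 uns in auto)
  have "h u u \<noteq> 0"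
  proof
    assume "h u u = 0"
    then have "h u y = 0" if "y \<in> V" for y
      using that unfolding S mem_span3 by (auto simp: h_simps o)
    then have "u = 0" by (rule nondeg[OF uV])
    then show False using uns span_0 by auto
  qed
  then have "null_frame e u ((h u u / h e f) *\<^sub>R f) (h u u)"
    unfolding null_frame_def using e f ef fe uV o o' by (auto simp: h_simps V_intros)
  then show ?thesis using \<open>h u u \<noteq> 0\<close> ef by (metis divide_eq_0_iff)
qed

lemma null_frame_exists:
  assumes e: "e \<in> V" "e \<noteq> 0" "h e e = 0"
  shows "\<exists>u f \<epsilon>. null_frame e u f \<epsilon>"
proof -
  obtain f0 where f0: "f0 \<in> V" "h e f0 \<noteq> 0" using nondeg[OF e(1)] e(2) by blast
  define f where "f = f0 - (h f0 f0 / (2 * h e f0)) *\<^sub>R e"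
  have "f \<in> V" using f0 e by (simp add: f_def V_intros)
  moreover have "h f f = 0" using e f0 h(2)[of f0 e] by (simp add: f_def h_simps)
  moreover have "h e f \<noteq> 0" using e f0 by (simp add: f_def h_simps)
  ultimately show ?thesis using null_frame_exists_pair e by blast
qed

lemma null_orthogonal_parallel:
  assumes "e \<in> V" "e \<noteq> 0" "h e e = 0" "e' \<in> V" "h e' e' = 0" "h e e' = 0"
  shows "e' \<in> span {e}"
proof -
  obtain u f \<epsilon> where fr: "null_frame e u f \<epsilon>" using null_frame_exists assms by blast
  note a = fr[unfolded null_frame_def]
  obtain k l n where e': "e' = k *\<^sub>R e + l *\<^sub>R u + n *\<^sub>R f"
    using assms(4) unfolding null_frame_spans[OF fr] mem_span3 by blast
  have "n = 0" using assms(6) a by (simp add: e' h_simps)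
  then have "l = 0" using assms(5) a by (simp add: e' h_simps)
  then show ?thesis using \<open>n = 0\<close> by (simp add: e' span_base span_scale)
qed

lemma adapted_parallel:
  assumes "adapted e" "e' \<in> span {e}" "e' \<noteq> 0"
  shows "adapted e'"
proof -
  obtain k where k: "e' = k *\<^sub>R e" using assms(2) unfolding mem_span1 by blast
  then have k0: "k \<noteq> 0" using assms(3) by auto
  have "span {e'} = span {e}" unfolding k using k0 by (simp add: span_image_scale[of "{e}" "\<lambda>_. k", simplified])
  then show ?thesis
    using assms(1) k k0 unfolding adapted_def by (auto simp: h_simps D_simps V_intros)
qed

lemma adapted_trivial:
  assumes "\<forall>x\<in>V. \<forall>y\<in>V. D x y = 0" "e \<in> V" "e \<noteq> 0" "h e e = 0"
  shows "adapted e"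
  using assms by (simp add: adapted_def span_0 h_simps)

text \<open>Triangularity and symmetry leave two further constants, the coefficients of \<open>e\<close> in \<open>D e u\<close> and in
  \<open>D u u\<close>. Flatness on \<open>e, u, f\<close> and on \<open>u, f, f\<close> says that their squares vanish.\<close>

lemma adapted_normal_form:
  assumes ad: "adapted e" and fr: "null_frame e u f \<epsilon>"
  obtains r t w where
    "D e e = 0" "D e u = 0" "D e f = 0" "D u e = 0" "D u u = 0" "D u f = r *\<^sub>R e"
    "D f e = 0" "D f u = t *\<^sub>R e" "D f f = w *\<^sub>R e + (2 * r - t) *\<^sub>R u"
proof -
  note a = fr[unfolded null_frame_def]
  have m: "e \<in> V" "u \<in> V" "f \<in> V" "e \<noteq> 0" using a ad unfolding adapted_def by auto
  have o: "h e e = 0" "h f f = 0" "h e u = 0" "h u e = 0" "h u f = 0" "h f u = 0" "h u u = \<epsilon>" "h e f = \<epsilon>"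
    "h f e = \<epsilon>" and eps: "\<epsilon> \<noteq> 0" using a by auto
  have ex: "\<exists>p s q. D x e = 0 \<and> D x u = p *\<^sub>R e \<and> D x f = s *\<^sub>R e + q *\<^sub>R u" if x: "x \<in> V" for x
  proof -
    have "D x e = 0" "D x u \<in> span {e}" "h (D x f) e = 0" "D x f \<in> V"
      using ad x m o unfolding adapted_def by (auto simp: D)
    moreover obtain s q n where "D x f = s *\<^sub>R e + q *\<^sub>R u + n *\<^sub>R f"
      using calculation(4) unfolding null_frame_spans[OF fr] mem_span3 by blast
    moreover have "n = 0" using calculation o eps by (simp add: h_simps)
    ultimately show ?thesis unfolding mem_span1 by auto
  qed
  obtain p1 s1 q1 p2 s2 q2 p3 s3 q3 where c: "D e e = 0" "D u e = 0" "D f e = 0"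
    "D e u = p1 *\<^sub>R e" "D u u = p2 *\<^sub>R e" "D f u = p3 *\<^sub>R e"
    "D e f = s1 *\<^sub>R e + q1 *\<^sub>R u" "D u f = s2 *\<^sub>R e + q2 *\<^sub>R u" "D f f = s3 *\<^sub>R e + q3 *\<^sub>R u"
    using ex[OF m(1)] ex[OF m(2)] ex[OF m(3)] by metis
  note C = codazzi[OF m(1) m(2) m(3)] codazzi[OF m(1) m(3) m(3)] codazzi[OF m(2) m(3) m(2)]
    codazzi[OF m(2) m(3) m(3)]
  have z: "q1 = - p1" "s1 = 0" "q2 = - p2" "q3 = 2 * s2 - p3"
    using C[unfolded c] eps
    by (auto simp: h_simps o simp flip: distrib_right distrib_left)
  have "D (D e u - D u e) f = D e (D u f) - D u (D e f)" by (rule flat[OF m(1,2,3)])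
  then have "(p1 * p1) *\<^sub>R u = 0" by (simp add: c z D_simps algebra_simps)
  moreover have "u \<noteq> 0" using o eps by (auto simp: h_simps)
  ultimately have p1: "p1 = 0" by simp
  have "D (D u f - D f u) f = D u (D f f) - D f (D u f)" by (rule flat[OF m(2,3,3)])
  then have "h (D (D u f - D f u) f) u = h (D u (D f f) - D f (D u f)) u" by simp
  then have "p2 = 0" using eps by (simp add: c z p1 D_simps h_simps o)
  then show ?thesis using that[of s2 p3 s3] c z p1 by simp
qed

end

section \<open>The two Hessian structures of a Born structure\<close>

text \<open>With \<open>span S\<close> and \<open>span T\<close> meeting only in \<open>0\<close>, a dependence within \<open>S \<union> T\<close> splits into one within \<open>S\<close>
  and one within \<open>T\<close>.\<close>

lemma independent_Un_direct:
  fixes S T :: "'a::real_vector set"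
  assumes S: "independent S" and T: "independent T" and ST: "span S \<inter> span T = {0}"
  shows "independent (S \<union> T)"
proof -
  have *: False if "a \<in> S" "a \<in> span (S \<union> T - {a})" "independent S" "span S \<inter> span T = {0}" for a and S T :: "'a set"
  proof -
    have "a \<in> span ((S - {a}) \<union> T)" using that(2) span_mono[of "S \<union> T - {a}" "(S - {a}) \<union> T"] by auto
    then obtain s t where st: "a = s + t" "s \<in> span (S - {a})" "t \<in> span T" unfolding span_Un by blast
    have "s \<in> span S" using st(2) span_mono[of "S - {a}" S] by auto
    moreover have "t = a - s" using st(1) by simp
    ultimately have "t \<in> span S" using that(1) by (simp add: span_base span_diff)
    then have "t = 0" using st(3) that(4) by blast
    then have "a \<in> span (S - {a})" using st by simp
    then show False using that(1,3) unfolding dependent_def by blast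
  qed
  show ?thesis unfolding dependent_def
    using *[of _ S T] *[of _ T S] S T ST by (auto simp: Un_commute Int_commute)
qed

text \<open>\<open>V\<close> is the \<open>+1\<close>-eigenspace of \<open>A\<close>, its image under \<open>J\<close> is the \<open>-1\<close>-eigenspace, and \<open>p\<close> is the projection
  to \<open>V\<close> along \<open>J ` V\<close>. Having \<open>p\<close> as a linear map on the whole space allows the products on \<open>V\<close> to be
  extended to bilinear maps, so that their expansion rules need no side conditions.\<close>

locale nilpotent_born =
  fixes br :: "'a::real_vector \<Rightarrow> 'a \<Rightarrow> 'a" and h :: "'a \<Rightarrow> 'a \<Rightarrow> real" and J p :: "'a \<Rightarrow> 'a"
    and V :: "'a set"
  assumes lie: "lie_algebra br" and dim6: "dim (UNIV :: 'a set) = 6" and nil: "nilpotent_lie br"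
    and h: "bilinear h" "h x y = h y x" "nondegenerate h"
    and J: "linear J" "J (J x) = - x" "h (J x) (J y) = h x y"
    and V: "subspace V" "V \<inter> J ` V = {0}"
    and p: "linear p" "p x \<in> V" "x - p x \<in> J ` V"
    and orth: "\<lbrakk>x \<in> V; y \<in> V\<rbrakk> \<Longrightarrow> h x (J y) = 0"
    and closed: "ce_d2 br (\<lambda>a b. h (J a) b) x y z = 0"
    and nij: "nijenhuis br J x y = 0"
    and sub: "lie_subalgebra br V" "lie_subalgebra br (J ` V)"
begin

lemma br: "bilinear br" "br x x = 0" "br x (br y z) + br y (br z x) + br z (br x y) = 0"
  using lie by (auto simp: lie_algebra_def)

lemmas br_simps = bilinear_ladd[OF br(1)] bilinear_radd[OF br(1)] bilinear_lsub[OF br(1)]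
  bilinear_rsub[OF br(1)] bilinear_lmul[OF br(1)] bilinear_rmul[OF br(1)] bilinear_lneg[OF br(1)]
  bilinear_rneg[OF br(1)] bilinear_lzero[OF br(1)] bilinear_rzero[OF br(1)]

lemmas h_simps = bilinear_ladd[OF h(1)] bilinear_radd[OF h(1)] bilinear_lsub[OF h(1)]
  bilinear_rsub[OF h(1)] bilinear_lmul[OF h(1)] bilinear_rmul[OF h(1)] bilinear_lneg[OF h(1)]
  bilinear_rneg[OF h(1)] bilinear_lzero[OF h(1)] bilinear_rzero[OF h(1)]

lemmas J_simps = linear_add[OF J(1)] linear_diff[OF J(1)] linear_scale[OF J(1)] linear_neg[OF J(1)]
  linear_0[OF J(1)] J(2,3)

lemmas p_simps = linear_add[OF p(1)] linear_diff[OF p(1)] linear_scale[OF p(1)] linear_neg[OF p(1)]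
  linear_0[OF p(1)]

lemmas V_intros = subspace_add[OF V(1)] subspace_diff[OF V(1)] subspace_scale[OF V(1)]
  subspace_neg[OF V(1)] subspace_0[OF V(1)] p(2)

lemma br_skew: "br x y = - br y x"
proof -
  have "br (x + y) (x + y) = br x x + br y y + (br x y + br y x)"
    unfolding br_simps by (simp add: algebra_simps)
  then have "br x y + br y x = 0" by (simp only: br(2)) simp
  then show ?thesis by (simp only: eq_neg_iff_add_eq_0)
qed

lemma JV: "subspace (J ` V)" using V(1) J(1) by (rule linear_subspace_image[rotated])

lemma J_eq: "J x = J y \<longleftrightarrow> x = y" by (metis J(2) minus_minus)

lemma split_unique:
  assumes "a \<in> V" "b \<in> V" "c \<in> V" "d \<in> V" "a + J b = c + J d"
  shows "a = c" "b = d"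
proof -
  have "a - c = J (d - b)" using assms(5) by (simp add: J_simps algebra_simps)
  moreover have "a - c \<in> V" "d - b \<in> V" using assms by (auto intro: V_intros)
  ultimately have "a - c \<in> V \<inter> J ` V" by auto
  then show "a = c" using V(2) by auto
  then show "b = d" using assms(5) J_eq by simp
qed

lemma p_eq: "a \<in> V \<Longrightarrow> b \<in> V \<Longrightarrow> p (a + J b) = a"
proof -
  assume a: "a \<in> V" "b \<in> V"
  obtain d where d: "d \<in> V" "(a + J b) - p (a + J b) = J d" using p(3)[of "a + J b"] by blast
  then have "a + J b = p (a + J b) + J d" by (simp add: algebra_simps)
  then show ?thesis using split_unique(1)[OF a p(2) d(1)] by metis
qed

lemma pV: "a \<in> V \<Longrightarrow> p a = a" using p_eq[of a 0] V_intros(5) by (simp add: J_simps)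

lemma pJ: "b \<in> V \<Longrightarrow> p (J b) = 0" using p_eq[of 0 b] V_intros(5) by simp

lemma decompose: "w = p w + J (- p (J w))"
proof -
  obtain d where d: "d \<in> V" "w - p w = J d" using p(3)[of w] by blast
  have "J w = J (p w) - d" using arg_cong[OF d(2), of J] by (simp add: J_simps algebra_simps)
  then have "p (J w) = - d" using d by (simp add: p_simps pJ pV p(2))
  then show ?thesis using d(2) by (simp add: algebra_simps)
qed

lemma dimV: "dim V = 3"
proof -
  obtain B where B: "B \<subseteq> V" "independent B" "V \<subseteq> span B" "card B = dim V"
    using basis_exists by blast
  have sB: "span B = V" using B V(1) by (simp add: span_subspace)
  have sJ: "span (J ` B) = J ` V" using linear_span_image[OF J(1), of B] sB by simp
  have injJ: "inj J" using J_eq by (simp add: inj_def)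
  have iJ: "independent (J ` B)"
    using B(2) J(1) injJ by (metis linear_independent_injective_image inj_on_subset subset_UNIV)
  have "0 \<notin> B" using B(2) dependent_zero by blast
  moreover have "B \<inter> J ` B \<subseteq> {0}" using V(2) B(1) by blast
  ultimately have dis: "B \<inter> J ` B = {}" by auto
  have ind: "independent (B \<union> J ` B)" using independent_Un_direct[OF B(2) iJ] V(2) sB sJ by simp
  have "x \<in> span (B \<union> J ` B)" for x
    unfolding span_Un sB sJ using decompose[of x] p(2) V_intros(4)[OF p(2)] by blast
  then have "span (B \<union> J ` B) = UNIV" by blast
  then have "card (B \<union> J ` B) = 6" using dim_eq_card[of "B \<union> J ` B" UNIV] ind dim6 by simp
  moreover from this have "finite B" by (metis card.infinite finite_Un zero_neq_numeral)
  ultimately have "card B + card (J ` B) = 6" using dis by (simp add: card_Un_disjoint)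
  moreover have "card (J ` B) = card B" using injJ by (simp add: card_image inj_on_subset)
  ultimately show ?thesis using B(4) by simp
qed

text \<open>On \<open>V\<close>, \<open>J (D x z)\<close> is the component of \<open>[x, Jz]\<close> in \<open>J ` V\<close>, and \<open>D' x z\<close> is the component of
  \<open>[Jx, z]\<close> in \<open>V\<close>: the Bott connections of the two complementary subalgebras, with \<open>J ` V\<close>
  identified with \<open>V\<close> by \<open>J\<close>.\<close>

definition D :: "'a \<Rightarrow> 'a \<Rightarrow> 'a" where "D x z = - p (J (br (p x) (J (p z))))"

definition D' :: "'a \<Rightarrow> 'a \<Rightarrow> 'a" where "D' x z = p (br (J (p x)) (p z))"

lemma D_bil: "bilinear D"
  unfolding bilinear_def D_def by (auto intro!: linearI simp: p_simps J_simps br_simps)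

lemma D'_bil: "bilinear D'"
  unfolding bilinear_def D'_def by (auto intro!: linearI simp: p_simps J_simps br_simps)

lemma DV: "D x y \<in> V" "D' x y \<in> V" by (auto simp: D_def D'_def intro: V_intros)

lemma br_mixed:
  assumes "x \<in> V" "z \<in> V"
  shows "br x (J z) = J (D x z) - D' z x" "br (J z) x = D' z x - J (D x z)"
proof -
  have "p (br x (J z)) = - D' z x"
    using br_skew[of x "J z"] by (simp add: D'_def pV assms p_simps)
  then show "br x (J z) = J (D x z) - D' z x"
    using decompose[of "br x (J z)"] by (simp add: D_def pV assms)
  then show "br (J z) x = D' z x - J (D x z)" using br_skew[of "J z" x] by simp
qed

text \<open>The two components of the Nijenhuis tensor on \<open>V\<close>.\<close>

lemma torsion_free:
  assumes x: "x \<in> V" and y: "y \<in> V"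
  shows "br x y = D x y - D y x" "br (J x) (J y) = J (D' x y - D' y x)"
proof -
  obtain k where k: "k \<in> V" "br (J x) (J y) = J k"
    using sub(2) x y unfolding lie_subalgebra_def by blast
  have b: "br x y \<in> V" using sub(1) x y unfolding lie_subalgebra_def by blast
  have "J k - J (D' x y - J (D y x)) - J (J (D x y) - D' y x) - br x y = 0"
    using nij[of x y] br_mixed(1)[OF x y] br_mixed(2)[OF y x] by (simp add: nijenhuis_def J_simps k)
  then have "br x y + J (D' x y - D' y x) = (D x y - D y x) + J k"
    by (simp add: J_simps algebra_simps)
  note s = split_unique[OF b _ _ k(1) this]
  show "br x y = D x y - D y x" "br (J x) (J y) = J (D' x y - D' y x)"
    using s k by (auto intro!: V_intros DV)
qed

lemma orth': "x \<in> V \<Longrightarrow> y \<in> V \<Longrightarrow> h (J x) y = 0" using orth h(2) by metis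

text \<open>Closedness of \<open>\<omega>\<close> on \<open>x, y, Jz\<close>, and below on \<open>Jx, Jy, z\<close>.\<close>

lemma D_codazzi:
  assumes "x \<in> V" "y \<in> V" "z \<in> V"
  shows "h (D x y) z + h y (D x z) = h (D y x) z + h x (D y z)"
  using closed[of x y "J z"] h(2)[of y "D x z"] h(2)[of x "D y z"]
  by (simp add: ce_d2_def torsion_free assms br_mixed J_simps h_simps orth orth' DV)

lemma D'_codazzi:
  assumes "x \<in> V" "y \<in> V" "z \<in> V"
  shows "h (D' x y) z + h y (D' x z) = h (D' y x) z + h x (D' y z)"
  using closed[of "J x" "J y" z] h(2)[of y "D' x z"] h(2)[of x "D' y z"]
  by (simp add: ce_d2_def torsion_free assms br_mixed J_simps h_simps orth orth' DV)

lemmas D_simps = bilinear_ladd[OF D_bil] bilinear_radd[OF D_bil] bilinear_lsub[OF D_bil]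
  bilinear_rsub[OF D_bil] bilinear_lmul[OF D_bil] bilinear_rmul[OF D_bil] bilinear_lneg[OF D_bil]
  bilinear_rneg[OF D_bil] bilinear_lzero[OF D_bil] bilinear_rzero[OF D_bil]

lemmas D'_simps = bilinear_ladd[OF D'_bil] bilinear_radd[OF D'_bil] bilinear_lsub[OF D'_bil]
  bilinear_rsub[OF D'_bil] bilinear_lmul[OF D'_bil] bilinear_rmul[OF D'_bil] bilinear_lneg[OF D'_bil]
  bilinear_rneg[OF D'_bil] bilinear_lzero[OF D'_bil] bilinear_rzero[OF D'_bil]

lemma jacobi: "br (br x y) z = br x (br y z) - br y (br x z)"
proof -
  have "br y (br z x) = - br y (br x z)"
    by (subst br_skew[of z x]) (rule bilinear_rneg[OF br(1)])
  then have "br x (br y z) + - br y (br x z) + - br (br x y) z = 0"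
    using br(3)[of x y z] br_skew[of z "br x y"] by simp
  then show ?thesis by (simp add: algebra_simps)
qed

text \<open>The components in \<open>J ` V\<close> and in \<open>V\<close> of the Jacobi identity for \<open>x, y, Jz\<close>: flatness of \<open>D\<close>, and the
  compatibility between \<open>D\<close> and \<open>D'\<close>.\<close>

lemma jacobi_components:
  assumes "x \<in> V" "y \<in> V" "z \<in> V"
  shows "D (D x y - D y x) z = D x (D y z) - D y (D x z)"
    and "D' z (D x y - D y x) = D' (D y z) x + (D x (D' z y) - D (D' z y) x)
       - D' (D x z) y - (D y (D' z x) - D (D' z x) y)"
proof -
  note m = assms DV
  have "br (br x y) (J z) = br x (br y (J z)) - br y (br x (J z))" by (rule jacobi)
  then have "J (D (D x y - D y x) z) - D' z (D x y - D y x)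
    = J (D x (D y z)) - D' (D y z) x - (D x (D' z y) - D (D' z y) x)
      - (J (D y (D x z)) - D' (D x z) y - (D y (D' z x) - D (D' z x) y))"
    using m by (simp add: torsion_free br_mixed br_simps V_intros D_simps D'_simps J_simps algebra_simps)
  then have e: "- D' z (D x y - D y x) + J (D (D x y - D y x) z) =
    (- D' (D y z) x - (D x (D' z y) - D (D' z y) x) + D' (D x z) y + (D y (D' z x) - D (D' z x) y))
    + J (D x (D y z) - D y (D x z))"
    by (simp add: J_simps algebra_simps)
  note s = split_unique[OF _ _ _ _ e]
  have i: "- D' z (D x y - D y x) \<in> V" "D (D x y - D y x) z \<in> V" "D x (D y z) - D y (D x z) \<in> V"
    "- D' (D y z) x - (D x (D' z y) - D (D' z y) x) + D' (D x z) y + (D y (D' z x) - D (D' z x) y) \<in> V"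
    by (intro V_intros DV)+
  show "D (D x y - D y x) z = D x (D y z) - D y (D x z)" by (rule s(2)[OF i(1,2,4,3)])
  have "- (- D' z (D x y - D y x)) = - (- D' (D y z) x - (D x (D' z y) - D (D' z y) x)
    + D' (D x z) y + (D y (D' z x) - D (D' z x) y))"
    by (simp only: s(1)[OF i(1,2,4,3)])
  then show "D' z (D x y - D y x) = D' (D y z) x + (D x (D' z y) - D (D' z y) x)
       - D' (D x z) y - (D y (D' z x) - D (D' z x) y)" by (simp add: algebra_simps)
qed

lemma D'_flat:
  assumes "x \<in> V" "y \<in> V" "z \<in> V"
  shows "D' (D' x y - D' y x) z = D' x (D' y z) - D' y (D' x z)"
proof -
  have "p (br (br (J x) (J y)) z) = p (br (J x) (br (J y) z)) - p (br (J y) (br (J x) z))"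
    by (simp add: jacobi p_simps)
  moreover have "p (br (J x) (J y)) = 0" if "x \<in> V" "y \<in> V" for x y
    using that by (simp add: torsion_free pJ V_intros DV)
  ultimately show ?thesis
    using assms by (simp add: torsion_free br_mixed br_simps V_intros DV p_simps pV pJ)
qed

text \<open>A form of Engel's theorem that uses the lower central series of the whole algebra. The map \<open>F\<close>
  embeds \<open>V\<close> transversally to \<open>W\<close>, and \<open>E x\<close> is the action on \<open>\<gg> / W\<close> of some element that
  stabilises \<open>W\<close>. The vectors of \<open>V\<close> that \<open>F\<close> sends into the \<open>k\<close>-th term plus \<open>W\<close> form a filtration that
  every \<open>E x\<close> lowers by one step; a vector outside \<open>S\<close> of the greatest possible degree is mapped into \<open>S\<close>.\<close>

lemma nilpotent_action:
  assumes S: "0 \<in> S" "S \<subset> V" and F: "linear F" "\<And>x. x \<in> V \<Longrightarrow> F x = 0 \<Longrightarrow> x = 0" "F ` V \<inter> W = {0}"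
    and step: "\<And>x z. \<lbrakk>x \<in> V; z \<in> V\<rbrakk> \<Longrightarrow> \<exists>a. br a ` W \<subseteq> W \<and> F (E x z) - br a (F z) \<in> W"
    and W: "subspace W" and E: "\<And>x z. E x z \<in> V"
  shows "\<exists>v\<in>V - S. \<forall>x\<in>V. E x v \<in> S"
proof -
  let ?G = "lower_central_series br"
  let ?W = "\<lambda>k. {z \<in> V. \<exists>g\<in>?G k. \<exists>u\<in>W. F z = g + u}"
  obtain n where n: "?G n = {0}" using nil unfolding nilpotent_lie_def by blast
  have "?W n \<subseteq> S"
  proof
    fix z assume z: "z \<in> ?W n"
    then have "F z \<in> F ` V \<inter> W" using n by auto
    then show "z \<in> S" using F z S by auto
  qed
  moreover have "\<not> ?W 0 \<subseteq> S"
  proof -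
    obtain v where v: "v \<in> V" "v \<notin> S" using S by blast
    have "\<exists>g\<in>?G 0. \<exists>u\<in>W. F v = g + u"
      using subspace_0[OF W] by (intro bexI[of _ "F v"] bexI[of _ 0]) auto
    then show ?thesis using v by blast
  qed
  ultimately obtain k where k: "\<not> ?W k \<subseteq> S" "?W (Suc k) \<subseteq> S"
    using ex_least_nat_less[of "\<lambda>k. ?W k \<subseteq> S" n] by blast
  then obtain v where v: "v \<in> ?W k" "v \<notin> S" by blast
  then obtain g w where gw: "v \<in> V" "g \<in> ?G k" "w \<in> W" "F v = g + w" by blast
  have "E x v \<in> S" if x: "x \<in> V" for x
  proof -
    obtain a where a: "br a ` W \<subseteq> W" "F (E x v) - br a (F v) \<in> W"
      using step[OF x gw(1)] by blast
    define u where "u = F (E x v) - br a (F v)"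
    have "F (E x v) = br a g + (br a w + u)" unfolding u_def gw(4) by (simp add: br_simps)
    moreover have "br a g \<in> ?G (Suc k)" using gw(2) by (auto intro!: span_base)
    moreover have "br a w + u \<in> W" using a gw(3) W by (intro subspace_add) (auto simp: u_def)
    ultimately have "E x v \<in> ?W (Suc k)" using E by blast
    then show ?thesis using k(2) by blast
  qed
  then show ?thesis using v gw by blast
qed

sublocale H: nilpotent_hessian V h D
proof
  fix S assume S: "subspace S" "S \<subseteq> V" "S \<noteq> V"
  show "\<exists>v\<in>V - S. \<forall>x\<in>V. D x v \<in> S"
  proof (rule nilpotent_action[where F = J and W = V])
    show "J ` V \<inter> V = {0}" using V(2) by blast
    show "x = 0" if "J x = 0" for x using J_eq[of x 0] that by (simp add: J_simps)
    show "\<exists>a. br a ` V \<subseteq> V \<and> J (D x z) - br a (J z) \<in> V" if "x \<in> V" "z \<in> V" for x z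
      using that sub(1) unfolding lie_subalgebra_def
      by (intro exI[of _ x]) (auto simp: br_mixed DV)
  qed (use S V J DV subspace_0[OF S(1)] in auto)
next
  show "x = 0" if "x \<in> V" "\<And>y. y \<in> V \<Longrightarrow> h x y = 0" for x
  proof -
    have "h x (p y + J (- p (J y))) = 0" for y
      using that(2)[OF p(2)[of y]] orth[OF that(1) V_intros(4)[OF p(2)[of "J y"]]]
      by (simp add: bilinear_radd[OF h(1)])
    then have "h x y = 0" for y by (metis decompose)
    then show ?thesis using h(3) by (simp add: nondegenerate_def)
  qed
qed (use V h D_bil DV D_codazzi jacobi_components(1) dimV in auto)

sublocale H': nilpotent_hessian V h D'
proof
  fix S assume S: "subspace S" "S \<subseteq> V" "S \<noteq> V"
  show "\<exists>v\<in>V - S. \<forall>x\<in>V. D' x v \<in> S"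
  proof (rule nilpotent_action[where F = "\<lambda>x. x" and W = "J ` V"])
    show "\<exists>a. br a ` (J ` V) \<subseteq> J ` V \<and> D' x z - br a z \<in> J ` V" if "x \<in> V" "z \<in> V" for x z
      using that sub(2) unfolding lie_subalgebra_def
      by (intro exI[of _ "J x"]) (auto simp: br_mixed DV)
  qed (use S V JV DV subspace_0[OF S(1)] linear_ident in auto)
qed (use H.nondeg V h D'_bil DV D'_codazzi D'_flat dimV in auto)

text \<open>Transverse null vectors form a common frame \<open>e, u, g\<close> in which \<open>D\<close> and \<open>D'\<close> have normal form with the
  roles of \<open>e\<close> and \<open>g\<close> exchanged. Evaluating the compatibility on five triples of frame vectors yields
  polynomial equations that annihilate all constants of \<open>D\<close> or all those of \<open>D'\<close>.\<close>

lemma transverse_trivial: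
  assumes e: "H.adapted e" and f: "H'.adapted f" and ef: "h e f \<noteq> 0"
  shows "(\<forall>x\<in>V. \<forall>y\<in>V. D x y = 0) \<or> (\<forall>x\<in>V. \<forall>y\<in>V. D' x y = 0)"
proof -
  have m0: "e \<in> V" "h e e = 0" "f \<in> V" "h f f = 0" using e f by (auto simp: H.adapted_def H'.adapted_def)
  obtain u k \<epsilon> where k: "k \<noteq> 0" and fr: "H.null_frame e u (k *\<^sub>R f) \<epsilon>"
    using H.null_frame_exists_pair[OF m0 ef] by blast
  define g where "g = k *\<^sub>R f"
  have g: "H'.adapted g" using H'.adapted_parallel[OF f, of g] k f
    by (auto simp: g_def span_base span_scale H'.adapted_def)
  have fr1: "H.null_frame e u g \<epsilon>" using fr by (simp add: g_def)
  then have fr2: "H'.null_frame g u e \<epsilon>" by (auto simp: H.null_frame_def H'.null_frame_def)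
  note a = fr1[unfolded H.null_frame_def]
  then have m: "e \<in> V" "u \<in> V" "g \<in> V" by auto
  obtain r t w where c:
    "D e e = 0" "D e u = 0" "D e g = 0" "D u e = 0" "D u u = 0" "D u g = r *\<^sub>R e"
    "D g e = 0" "D g u = t *\<^sub>R e" "D g g = w *\<^sub>R e + (2 * r - t) *\<^sub>R u"
    by (rule H.adapted_normal_form[OF e fr1])
  obtain r' t' w' where c':
    "D' g g = 0" "D' g u = 0" "D' g e = 0" "D' u g = 0" "D' u u = 0" "D' u e = r' *\<^sub>R g"
    "D' e g = 0" "D' e u = t' *\<^sub>R g" "D' e e = w' *\<^sub>R g + (2 * r' - t') *\<^sub>R u"
    by (rule H'.adapted_normal_form[OF g fr2])
  have o: "h e e = 0" "h g g = 0" "h e u = 0" "h u e = 0" "h u g = 0" "h g u = 0" "h u u = \<epsilon>" "h e g = \<epsilon>"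
    "h g e = \<epsilon>" "\<epsilon> \<noteq> 0" using a by auto
  have lin: "x = 0 \<and> y = 0 \<and> z = 0" if "x *\<^sub>R e + y *\<^sub>R u + z *\<^sub>R g = 0" for x y z
    using arg_cong[OF that, of "\<lambda>v. h v e"] arg_cong[OF that, of "\<lambda>v. h v u"] arg_cong[OF that, of "\<lambda>v. h v g"] o
    by (simp add: h_simps)
  have ne: "e \<noteq> 0" "u \<noteq> 0" "g \<noteq> 0" using o by (auto simp: h_simps)
  note j = jacobi_components(2)
  have j1: "r * w' = 0" "r * (2 * r' - t') = 0"
    using j[OF m(2,1,3)] lin[of 0 "r * (2 * r' - t')" "r * w'"]
    by (simp_all add: c c' D_simps D'_simps algebra_simps)
  have j2: "t * w' = 0" "t * (2 * r' - t') = 0"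
    using j[OF m(1,3,2)] lin[of 0 "t * (2 * r' - t')" "t * w'"]
    by (simp_all add: c c' D_simps D'_simps algebra_simps)
  have j3: "w * w' + (2 * r - t) * r' = 0" "w * (2 * r' - t') = 0"
    using j[OF m(1,3,3)] lin[of 0 "w * (2 * r' - t')" "w * w' + (2 * r - t) * r'"]
    by (simp_all add: c c' D_simps D'_simps algebra_simps)
  have j4: "r' * (r - t) = 0"
    using j[OF m(2,1,2)] lin[of "r' * (r - t)" 0 0]
    by (auto simp add: c c' ne D_simps D'_simps algebra_simps)
  have j5: "w * t' = 0"
    using j[OF m(2,3,3)] lin[of 0 0 "w * t'"]
    by (simp add: c c' ne D_simps D'_simps algebra_simps)
  consider "r = 0" "t = 0" "w = 0" | "w' = 0" "2 * r' - t' = 0" "r' = 0"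
    using j1 j2 j3 j4 j5 by (auto simp: algebra_simps) 
  then show ?thesis
  proof cases
    case 1
    then have "D x y = 0" if "x \<in> V" "y \<in> V" for x y
      using that unfolding H.null_frame_spans[OF fr1] mem_span3 by (auto simp: D_simps c)
    then show ?thesis by blast
  next
    case 2
    then have "D' x y = 0" if "x \<in> V" "y \<in> V" for x y
      using that unfolding H.null_frame_spans[OF fr1] mem_span3 by (auto simp: D'_simps c')
    then show ?thesis by blast
  qed
qed

lemma common_adapted:
  assumes "\<not> abelian_lie br"
  shows "\<exists>e. H.adapted e \<and> H'.adapted e"
proof -
  let ?Z = "\<forall>x\<in>V. \<forall>y\<in>V. D x y = 0" and ?Z' = "\<forall>x\<in>V. \<forall>y\<in>V. D' x y = 0"
  have nz: "\<not> (?Z \<and> ?Z')"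
  proof
    assume z: "?Z \<and> ?Z'"
    have "br x y = 0" for x y
    proof -
      obtain a b c d where "x = a + J b" "y = c + J d" "a \<in> V" "b \<in> V" "c \<in> V" "d \<in> V"
        using decompose V_intros(4)[OF p(2)] p(2) by metis
      then show ?thesis using z by (simp add: br_simps torsion_free br_mixed J_simps)
    qed
    then show False using assms by (simp add: abelian_lie_def)
  qed
  have one: ?thesis if z: "?Z'"
  proof -
    obtain e where "H.adapted e" using nz z H.adapted_exists by blast
    then show ?thesis using H'.adapted_trivial[OF z] unfolding H.adapted_def by blast
  qed
  have two: ?thesis if z: "?Z"
  proof -
    obtain e where "H'.adapted e" using nz z H'.adapted_exists by blast
    then show ?thesis using H.adapted_trivial[OF z] unfolding H'.adapted_def by blast
  qed
  show ?thesis
  proof (cases "?Z \<or> ?Z'")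
    case False
    then obtain e f where e: "H.adapted e" and f: "H'.adapted f"
      using H.adapted_exists H'.adapted_exists by blast
    then have "h e f = 0" using transverse_trivial False by blast
    then have "e \<in> span {f}"
      using H.null_orthogonal_parallel[of f e] e f h(2)[of e f] unfolding H.adapted_def H'.adapted_def by auto
    then have "H'.adapted e" using H'.adapted_parallel[OF f] e unfolding H.adapted_def by blast
    then show ?thesis using e by blast
  qed (use one two in blast)
qed

text \<open>The brackets of \<open>f, Jf, u, Ju, e, Je\<close> for a null frame in which both products have normal form.\<close>

lemma isomorphic_to_model:
  assumes "\<not> abelian_lie br"
  shows "\<exists>r q w r' q' w'. lie_isomorphic br (born_model r q w r' q' w')"
proof -
  obtain e where e: "H.adapted e" "H'.adapted e" using common_adapted[OF assms] by blast
  obtain u f \<epsilon> where fr: "H.null_frame e u f \<epsilon>"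
    using H.null_frame_exists e unfolding H.adapted_def by blast
  then have fr': "H'.null_frame e u f \<epsilon>" by (auto simp: H.null_frame_def H'.null_frame_def)
  note a = fr[unfolded H.null_frame_def]
  then have m: "e \<in> V" "u \<in> V" "f \<in> V" by auto
  obtain r t w where c:
    "D e e = 0" "D e u = 0" "D e f = 0" "D u e = 0" "D u u = 0" "D u f = r *\<^sub>R e"
    "D f e = 0" "D f u = t *\<^sub>R e" "D f f = w *\<^sub>R e + (2 * r - t) *\<^sub>R u"
    by (rule H.adapted_normal_form[OF e(1) fr])
  obtain r' t' w' where c':
    "D' e e = 0" "D' e u = 0" "D' e f = 0" "D' u e = 0" "D' u u = 0" "D' u f = r' *\<^sub>R e"
    "D' f e = 0" "D' f u = t' *\<^sub>R e" "D' f f = w' *\<^sub>R e + (2 * r' - t') *\<^sub>R u"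
    by (rule H'.adapted_normal_form[OF e(2) fr'])
  define v :: "real \<Rightarrow> real \<Rightarrow> real \<Rightarrow> 'a" where "v x y z = x *\<^sub>R f + y *\<^sub>R u + z *\<^sub>R e" for x y z
  define \<psi> :: "real^6 \<Rightarrow> 'a" where "\<psi> x = v (x$1) (x$3) (x$5) + J (v (x$2) (x$4) (x$6))" for x
  have vV: "v x y z \<in> V" for x y z using m by (simp add: v_def V_intros)
  have v0: "x = 0 \<and> y = 0 \<and> z = 0" if "v x y z = 0" for x y z
    using arg_cong[OF that, of "\<lambda>v. h v e"] arg_cong[OF that, of "\<lambda>v. h v u"] arg_cong[OF that, of "\<lambda>v. h v f"] a
    by (simp add: v_def h_simps)
  have lin: "linear \<psi>"
    by (rule linearI) (simp_all add: \<psi>_def v_def J_simps algebra_simps)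
  have inj: "x = 0" if "\<psi> x = 0" for x
  proof -
    have "v (x$1) (x$3) (x$5) + J (v (x$2) (x$4) (x$6)) = 0 + J 0" using that by (simp add: \<psi>_def J_simps)
    from split_unique[OF vV vV _ _ this] V_intros(5)
    have "v (x$1) (x$3) (x$5) = 0" "v (x$2) (x$4) (x$6) = 0" by blast+
    then show ?thesis using v0 by (simp add: vec_eq_iff forall_6)
  qed
  have surj: "\<exists>x. y = \<psi> x" for y
  proof -
    obtain b d where y: "y = b + J d" "b \<in> V" "d \<in> V"
      using decompose V_intros(4)[OF p(2)] p(2) by metis
    obtain b1 b2 b3 d1 d2 d3 where "b = v b1 b2 b3" "d = v d1 d2 d3"
      using y(2,3) unfolding H.null_frame_spans[OF fr] mem_span3 v_def by (metis add.commute add.left_commute)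
    then have "y = \<psi> (vec6 b1 d1 b2 d2 b3 d3)" using y by (simp add: \<psi>_def)
    then show ?thesis by blast
  qed
  have "bij \<psi>" unfolding bij_def
    using linear_injective_0[OF lin] inj surj by (auto simp: surj_def)
  moreover have "\<psi> (born_model r (2 * r - t) w r' (2 * r' - t') w' x y) = br (\<psi> x) (\<psi> y)" for x y
  proof -
    have Dv: "D (v x1 x2 x3) (v y1 y2 y3) = v 0 (x1 * y1 * (2 * r - t)) (x1 * y1 * w + x1 * y2 * t + x2 * y1 * r)"
      "D' (v x1 x2 x3) (v y1 y2 y3) = v 0 (x1 * y1 * (2 * r' - t')) (x1 * y1 * w' + x1 * y2 * t' + x2 * y1 * r')"
      for x1 x2 x3 y1 y2 y3
      by (simp_all add: v_def D_simps D'_simps c c' algebra_simps)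
    have vadd: "v x1 x2 x3 + v y1 y2 y3 = v (x1 + y1) (x2 + y2) (x3 + y3)"
      "v x1 x2 x3 - v y1 y2 y3 = v (x1 - y1) (x2 - y2) (x3 - y3)" for x1 x2 x3 y1 y2 y3
      by (simp_all add: v_def algebra_simps)
    define a b where "a = v (x$1) (x$3) (x$5)" and "b = v (x$2) (x$4) (x$6)"
    define a' b' where "a' = v (y$1) (y$3) (y$5)" and "b' = v (y$2) (y$4) (y$6)"
    have M: "a \<in> V" "b \<in> V" "a' \<in> V" "b' \<in> V" by (simp_all add: a_def b_def a'_def b'_def vV)
    have "br (\<psi> x) (\<psi> y) = br (a + J b) (a' + J b')" by (simp add: \<psi>_def a_def b_def a'_def b'_def)
    also have "\<dots> = (D a a' - D a' a) + (J (D a b') - D' b' a) + (D' b a' - J (D a' b)) + J (D' b b' - D' b' b)"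
      using M by (simp add: br_simps torsion_free br_mixed)
    also have "\<dots> = ((D a a' - D a' a) + (D' b a' - D' b' a)) + J ((D a b' - D a' b) + (D' b b' - D' b' b))"
      by (simp add: J_simps algebra_simps)
    also have "\<dots> = \<psi> (born_model r (2 * r - t) w r' (2 * r' - t') w' x y)"
      unfolding a_def b_def a'_def b'_def Dv vadd \<psi>_def
      by (simp add: born_model_def Let_def algebra_simps)
    finally show ?thesis by simp
  qed
  ultimately have "lie_isomorphic (born_model r (2 * r - t) w r' (2 * r' - t') w') br"
    using lin unfolding lie_isomorphic_def by blast
  then show ?thesis using lie_isomorphic_sym by blast
qed

end

section \<open>The classification\<close>

lemma born_isomorphic_to_model:
  fixes br :: "'a::real_vector \<Rightarrow> 'a \<Rightarrow> 'a"
  assumes "lie_algebra br" "dim (UNIV :: 'a set) = 6" "nilpotent_lie br" "\<not> abelian_lie br"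
    and B: "integrable_born_structure br h J Vp Vm"
  shows "\<exists>r q w r' q' w'. lie_isomorphic br (born_model r q w r' q' w')"
proof -
  note E = B[unfolded integrable_born_structure_encoding]
  have h: "bilinear h" "\<And>x y. h x y = h y x" "nondegenerate h"
    using E unfolding pseudo_metric_def by blast+
  obtain g \<omega> A C where b: "born_structure g h \<omega> A C J" and V: "Vp = {x. A x = x}" "Vm = {x. A x = - x}"
    using B unfolding integrable_born_structure_def by blast
  have A: "linear A" "\<And>x. A (A x) = x"
    using b unfolding born_structure_def recursion_operator_def by blast+
  define p where "p x = (1/2) *\<^sub>R (x + A x)" for x
  have lp: "linear p"
    by (rule linearI) (simp_all add: p_def linear_add[OF A(1)] linear_scale[OF A(1)] algebra_simps)
  have p1: "p x \<in> Vp" for x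
    by (simp add: V p_def linear_add[OF A(1)] linear_scale[OF A(1)] A(2) add.commute)
  have p2: "x - p x \<in> Vm" for x
  proof -
    have "p x + (1/2) *\<^sub>R (x - A x) = (1/2) *\<^sub>R (x + x)"
      unfolding p_def by (simp only: scaleR_add_right[symmetric]) simp
    then have "x - p x = (1/2) *\<^sub>R (x - A x)" unfolding scaleR_half_double by (metis add_diff_cancel_left')
    then show ?thesis unfolding V
      by (simp only: mem_Collect_eq) (simp add: linear_diff[OF A(1)] linear_scale[OF A(1)] A(2) algebra_simps)
  qed
  interpret nilpotent_born br h J p Vp
  proof (rule nilpotent_born.intro)
    have im: "J ` Vp = Vm" and int: "Vp \<inter> Vm = {0}" using E by blast+
    have J: "linear J" "\<forall>x. J (J x) = - x" "\<forall>x y. h (J x) (J y) = h x y" "subspace Vp"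
      and int0: "\<forall>x y z. ce_d2 br (\<lambda>a b. h (J a) b) x y z = 0" "\<forall>x y. nijenhuis br J x y = 0"
      and sub: "lie_subalgebra br Vp" "lie_subalgebra br Vm"
      using E by simp_all
    show "linear J" by (rule J)
    show "J (J x) = - x" for x using J by blast
    show "h (J x) (J y) = h x y" for x y using J by blast
    show "subspace Vp" by (rule J)
    show "ce_d2 br (\<lambda>a b. h (J a) b) x y z = 0" for x y z using int0 by blast
    show "nijenhuis br J x y = 0" for x y using int0 by blast
    show "lie_subalgebra br Vp" by (rule sub)
    show "lie_subalgebra br (J ` Vp)" unfolding im by (rule sub)
    show "Vp \<inter> J ` Vp = {0}" unfolding im by (rule int)
    show "x - p x \<in> J ` Vp" for x unfolding im by (rule p2)
    show "h x (J y) = 0" if "x \<in> Vp" "y \<in> Vp" for x y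
    proof -
      have "J y \<in> Vm" using im that(2) by blast
      then show ?thesis using E that(1) by simp
    qed
  qed (fact h assms lp p1)+
  show ?thesis using isomorphic_to_model assms by blast
qed

theorem theorem4p3:
  fixes br :: "'a::real_vector \<Rightarrow> 'a \<Rightarrow> 'a"
  assumes "lie_algebra br"
    and "dim (UNIV :: 'a set) = 6"
    and "nilpotent_lie br"
    and "\<not> abelian_lie br"
  shows "(\<exists>h J Vp Vm. integrable_born_structure br h J Vp Vm) \<longleftrightarrow>
    lie_isomorphic br h4 \<or> lie_isomorphic br h7 \<or> lie_isomorphic br h8 \<or>
    lie_isomorphic br h9 \<or> lie_isomorphic br h10 \<or> lie_isomorphic br h11 \<or>
    lie_isomorphic br h13"
    (is "?born \<longleftrightarrow> ?list")
proof
  assume ?born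
  then obtain r q w r' q' w' where iso: "lie_isomorphic br (born_model r q w r' q' w')"
    using born_isomorphic_to_model[OF assms] by blast
  have "\<not> abelian_lie (born_model r q w r' q' w')"
    using abelian_lie_isomorphic[OF iso] assms(4) by blast
  from model_classification[OF this] show ?list
    by (elim disjE) (simp_all only: lie_isomorphic_trans[OF iso] simp_thms)
next
  assume ?list
  then have "\<exists>k\<in>{h4, h7, h8, h9, h10, h11, h13}. lie_isomorphic br k" by simp
  then obtain k where k: "k \<in> {h4, h7, h8, h9, h10, h11, h13}" "lie_isomorphic br k" by (elim bexE)
  from listed_algebra_is_model[OF k(1)]
  obtain r q w r' q' w' where "lie_isomorphic (born_model r q w r' q' w') k" by (elim exE)
  then have "lie_isomorphic br (born_model r q w r' q' w')"
    by (rule lie_isomorphic_trans[OF k(2) lie_isomorphic_sym])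
  moreover obtain h J Vp Vm where "integrable_born_structure (born_model r q w r' q' w') h J Vp Vm"
    using born_model_integrable by blast
  ultimately show ?born by (rule integrable_born_structure_transport)
qed

end
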